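(* The following hold: (i) $\Delta(\varepsilon)=2\varepsilon-1$ for $\tfrac{11}{16}\le\varepsilon\le1$, and $\Delta(\varepsilon)\ge 2\varepsilon-1$ for $\tfrac12\le\varepsilon\le\tfrac{11}{16}$; (ii) $\Delta(\varepsilon)\ge 0.591389\,\varepsilon^2$ for all $0<\varepsilon\le1$; (iii) $\Delta(\varepsilon)\ge 0.5546\,\varepsilon^2+0.088079\,\varepsilon^3$ for all $0<\varepsilon\le1$; (iv) $\Delta(\varepsilon)\le \tfrac{96}{121}\varepsilon^2<0.79339\,\varepsilon^2$ for $0<\varepsilon\le\tfrac{11}{16}$; (v) $\Delta(\varepsilon)\le \dfrac{\pi\varepsilon^2}{(1+\sqrt{1-\varepsilon})^2}=\tfrac{\pi}{4}\varepsilon^2+O(\varepsilon^3)$ for all $0<\varepsilon\le1$.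
   Context: Let $\lambda$ denote Lebesgue measure on $\mathbb{R}$. A set $C\subseteq\mathbb{R}$ is symmetric if there is a number $c$ such that $c+x\in C$ if and only if $c-x\in C$. For a measurable $A\subseteq\mathbb{R}$ let $D(A):=\sup\{\lambda(C): C\subseteq A,\ C \text{ measurable and symmetric}\}$. For $0\le\varepsilon\le1$ let $\Delta(\varepsilon):=\inf\{D(A): A\subseteq[0,1) \text{ measurable},\ \lambda(A)=\varepsilon\}$. *)

theory Defs
  imports "HOL-Analysis.Analysis" "HOL-Library.Landau_Symbols"
begin

definition symmetric_set :: "real set \<Rightarrow> bool" where
  "symmetric_set C \<longleftrightarrow> (\<exists>c. \<forall>x. c + x \<in> C \<longleftrightarrow> c - x \<in> C)"

definition D :: "real set \<Rightarrow> real" where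
  "D A = Sup {measure lebesgue C | C. C \<subseteq> A \<and> C \<in> sets lebesgue \<and> symmetric_set C}"

definition Delta :: "real \<Rightarrow> real" where
  "Delta \<epsilon> = Inf {D A | A. A \<in> sets lebesgue \<and> A \<subseteq> {0..<1} \<and> measure lebesgue A = \<epsilon>}"

end

theory Submission
  imports Defs "HOL-Probability.Probability" "HOL-Real_Asymp.Real_Asymp"
begin

text \<open>
  D A is the supremum over c of the measure of the overlap of A with its reflection c - A, that is,
  of the autoconvolution of the indicator function f of A.

  The linear lower bound is inclusion--exclusion for A and 1 - A. The other two lower bounds follow
  from it and D A \<ge> 0.61 \<epsilon>^2, which goes as follows. Let Q be the autocorrelation of f and K the
  triangular density of half-width 1/4, itself an autocorrelation. Smoothing f and its mirror image
  by a window of length 1/4, Cauchy--Schwarz bounds \<integral> Q K + D A from below; on the other hand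
  \<integral> Q = \<epsilon>^2 and \<integral> Q^2 equals the integral of the squared autoconvolution, hence is at most
  \<epsilon>^2 D A, so that \<integral> Q K cannot be large either.

  For the upper bounds, sets may be replaced by functions with values in the unit interval: given a
  step function on n cells, choose each cell independently with probability equal to the function
  value; by Hoeffding's inequality some choice has almost the same mean and autoconvolution. The two
  functions used are multiples of an explicit step function of mean 11/16, and
  min 1 (\<beta> / sqrt x) with \<beta> = 1 - sqrt (1 - \<epsilon>).
\<close>

subsection \<open>Random sets of cells\<close>

text \<open>Keeping only the smaller index of each pair with sum \<open>k\<close> makes the pairs
  \<open>{i, k - i}\<close> disjoint, and functions of disjoint blocks of independent coordinates
  are independent. This makes Hoeffding's inequality applicable to counts of
  representations.\<close>

lemma indep_pairs_Pi_pmf: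
  fixes q :: "nat \<Rightarrow> bool pmf"
  assumes "finite I" and L: "\<And>i. i \<in> L \<Longrightarrow> i \<in> I \<and> k - i \<in> I \<and> i \<le> k \<and> i < k - i"
  shows "prob_space.indep_vars (measure_pmf (Pi_pmf I dflt q)) (\<lambda>_. borel)
           (\<lambda>i \<omega>. of_bool (\<omega> i \<and> \<omega> (k - i)) :: real) L"
proof -
  define M where "M = measure_pmf (Pi_pmf I dflt q)"
  interpret prob_space M unfolding M_def by (rule measure_pmf.prob_space_axioms)
  let ?K = "\<lambda>i. {i, k - i}"
  have "indep_vars (\<lambda>_. count_space UNIV) (\<lambda>x f. f x) I"
    unfolding M_def by (rule indep_vars_Pi_pmf[OF \<open>finite I\<close>])
  then have "indep_vars (\<lambda>j. PiM (?K j) (\<lambda>_. count_space UNIV)) (\<lambda>j \<omega>. restrict (\<lambda>i. \<omega> i) (?K j)) L"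
  proof (rule indep_vars_restrict)
    show "disjoint_family_on ?K L"
      unfolding disjoint_family_on_def
    proof (intro ballI impI)
      fix i j assume "i \<in> L" "j \<in> L" "i \<noteq> j"
      with L[of i] L[of j] have "i \<le> k" "i < k - i" "j \<le> k" "j < k - j" by auto
      with \<open>i \<noteq> j\<close> show "?K i \<inter> ?K j = {}" by auto
    qed
  qed (use L in auto)
  then have "indep_vars (\<lambda>_. borel)
     (\<lambda>j \<omega>. (\<lambda>g. of_bool (g j \<and> g (k - j)) :: real) (restrict (\<lambda>i. \<omega> i) (?K j))) L"
  proof (rule indep_vars_compose2)
    fix i assume "i \<in> L"
    have *: "(\<lambda>g. g j) \<in> measurable (PiM (?K i) (\<lambda>_. count_space (UNIV::bool set))) (count_space UNIV)" 
      if "j \<in> ?K i" for j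
      using that by (rule measurable_component_singleton)
    have "(\<lambda>g. of_bool (g i \<and> g (k - i)) :: real) \<in>
        measurable (PiM (?K i) (\<lambda>_. count_space (UNIV::bool set))) borel"
      by (rule measurable_compose[OF _ measurable_of_bool]) (use * in measurable)
    then show "(\<lambda>g. of_bool (g i \<and> g (k - i)) :: real) \<in>
        measurable (PiM (?K i) (\<lambda>_. count_space (UNIV::bool set))) borel" .
  qed
  then show ?thesis by (simp add: M_def)
qed

lemma Pi_pmf_pair_expectation:
  fixes p :: "nat \<Rightarrow> real"
  assumes "finite I" "i \<in> I" "j \<in> I" "i \<noteq> j" "\<And>i. 0 \<le> p i \<and> p i \<le> 1"
  shows "measure_pmf.expectation (Pi_pmf I False (\<lambda>i. bernoulli_pmf (p i))) (\<lambda>\<omega>. of_bool (\<omega> i \<and> \<omega> j)) = p i * p j"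
proof -
  \<comment> \<open>Padding with the factor 1 outside \<open>{i, j}\<close> gives a product over all
    of \<open>I\<close>, whose expectation factors.\<close>
  define f :: "nat \<Rightarrow> bool \<Rightarrow> real" where "f = (\<lambda>x b. if x = i \<or> x = j then of_bool b else 1)"
  have "(\<lambda>\<omega>. of_bool (\<omega> i \<and> \<omega> j)) = (\<lambda>\<omega>. \<Prod>x\<in>I. f x (\<omega> x))"
  proof
    fix \<omega> :: "nat \<Rightarrow> bool"
    have "(\<Prod>x\<in>I. f x (\<omega> x)) = (\<Prod>x\<in>{i,j}. f x (\<omega> x))"
      by (rule prod.mono_neutral_right) (use assms in \<open>auto simp: f_def\<close>)
    then show "of_bool (\<omega> i \<and> \<omega> j) = (\<Prod>x\<in>I. f x (\<omega> x))"
      using assms by (simp add: f_def)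
  qed
  then have "measure_pmf.expectation (Pi_pmf I False (\<lambda>i. bernoulli_pmf (p i))) (\<lambda>\<omega>. of_bool (\<omega> i \<and> \<omega> j))
      = (\<Prod>x\<in>I. measure_pmf.expectation (bernoulli_pmf (p x)) (f x))"
    by (simp only:) (rule expectation_prod_Pi_pmf;
        use assms in \<open>auto simp: f_def integrable_measure_pmf_finite\<close>)
  also have "\<dots> = (\<Prod>x\<in>{i,j}. measure_pmf.expectation (bernoulli_pmf (p x)) (f x))"
    by (rule prod.mono_neutral_right) (use assms in \<open>auto simp: f_def\<close>)
  also have "\<dots> = p i * p j"
    using assms by (simp add: f_def)
  finally show ?thesis .
qed

text \<open>Representations of \<open>k\<close> come in mirror pairs, hence the factor 2; the extra
  1 pays for the possible diagonal one at \<open>k div 2\<close>.\<close>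

lemma card_sum_rep_le:
  fixes S :: "nat set"
  assumes "S \<subseteq> {..<n}"
  shows "card {i\<in>S. i \<le> k \<and> k - i \<in> S} \<le> 2 * card {i. i < n \<and> k - i < n \<and> i < k - i \<and> i \<in> S \<and> k - i \<in> S} + 1"
proof -
  let ?L = "{i. i < n \<and> k - i < n \<and> i < k - i \<and> i \<in> S \<and> k - i \<in> S}"
  have "{i\<in>S. i \<le> k \<and> k - i \<in> S} \<subseteq> ?L \<union> (\<lambda>i. k - i) ` ?L \<union> {k div 2}"
  proof
    fix i assume i: "i \<in> {i\<in>S. i \<le> k \<and> k - i \<in> S}"
    consider "i < k - i" | "k - i < i" | "i = k - i" by linarith
    then show "i \<in> ?L \<union> (\<lambda>i. k - i) ` ?L \<union> {k div 2}"
    proof cases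
      case 2
      then have "i = k - (k - i)" "k - i \<in> ?L" using i assms by auto
      then show ?thesis by blast
    qed (use i assms in auto)
  qed
  then have "card {i\<in>S. i \<le> k \<and> k - i \<in> S} \<le> card (?L \<union> (\<lambda>i. k - i) ` ?L \<union> {k div 2})"
    by (intro card_mono) auto
  also have "\<dots> \<le> card ?L + card ((\<lambda>i. k - i) ` ?L) + card {k div 2}"
    by (intro order.trans[OF card_Un_le] add_mono card_Un_le order.refl)
  also have "card ((\<lambda>i. k - i) ` ?L) \<le> card ?L" by (intro card_image_le) auto
  finally show ?thesis by simp
qed

text \<open>Put each \<open>i\<close> into \<open>S\<close> independently with probability
  \<open>p i\<close>. One event for the size and one for each \<open>k < 2 * n\<close> fail with
  probability at most \<open>exp (- 2 * \<eta>\<^sup>2 * n)\<close> each; hypothesis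
  \<open>n\<close> keeps the total below 1. Doubling the mirror pairs and adding the diagonal gives
  \<open>2 * \<eta> * n + 1\<close>.\<close>

lemma random_set_few_representations:
  fixes p :: "nat \<Rightarrow> real"
  assumes \<eta>: "0 < \<eta>" and n: "(2 * real n + 1) * exp (- 2 * \<eta>\<^sup>2 * real n) < 1"
    and p: "\<And>i. 0 \<le> p i \<and> p i \<le> 1"
    and c: "\<And>k. (\<Sum>i | i < n \<and> i \<le> k \<and> k - i < n. p i * p (k - i)) \<le> c"
  obtains S where "S \<subseteq> {..<n}" "real (card S) \<ge> (\<Sum>i<n. p i) - \<eta> * n"
    "\<And>k. real (card {i\<in>S. i \<le> k \<and> k - i \<in> S}) \<le> c + 2 * \<eta> * n + 1"
proof -
  have n0: "n > 0" using n by (cases n) auto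
  define M where "M = measure_pmf (Pi_pmf {..<n} False (\<lambda>i. bernoulli_pmf (p i)))"
  interpret prob_space M unfolding M_def by (rule measure_pmf.prob_space_axioms)
  have [simp]: "space M = UNIV" "events = UNIV" by (auto simp: M_def)
  define L where "L k = {i. i < n \<and> k - i < n \<and> i < k - i}" for k
  have finL: "finite (L k)" for k by (simp add: L_def)
  define Y where "Y = (\<lambda>(i::nat) \<omega>. of_bool (\<omega> i) :: real)"
  define Z where "Z = (\<lambda>(k::nat) i \<omega>. of_bool (\<omega> i \<and> \<omega> (k - i)) :: real)"
  \<comment> \<open>The bad events are too many mirror pairs with sum \<open>k\<close>
    (\<open>B k\<close>) and too few elements (\<open>B'\<close>).\<close>
  define B where "B k = {\<omega>. (\<Sum>i\<in>L k. Z k i \<omega>) \<ge> (\<Sum>i\<in>L k. p i * p (k - i)) + \<eta> * n}" for k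
  define B' where "B' = {\<omega>. (\<Sum>i<n. Y i \<omega>) \<le> (\<Sum>i<n. p i) - \<eta> * n}"
  have B'_prob: "prob B' \<le> exp (- 2 * \<eta>\<^sup>2 * n)"
  proof -
    have EY: "(\<Sum>i<n. expectation (Y i)) = (\<Sum>i<n. p i)"
    proof (rule sum.cong[OF refl])
      fix i assume "i \<in> {..<n}"
      then have "map_pmf (\<lambda>\<omega>. \<omega> i) (Pi_pmf {..<n} False (\<lambda>i. bernoulli_pmf (p i))) = bernoulli_pmf (p i)"
        by (subst Pi_pmf_component) auto
      then have "measure_pmf.expectation (bernoulli_pmf (p i)) (of_bool :: bool \<Rightarrow> real) = expectation (Y i)"
        unfolding Y_def M_def by (metis integral_map_pmf)
      then show "expectation (Y i) = p i" using p by simp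
    qed
    interpret H: Hoeffding_ineq M "{..<n}" Y "\<lambda>_. 0" "\<lambda>_. 1" "\<Sum>i<n. expectation (Y i)"
    proof unfold_locales
      have "indep_vars (\<lambda>_. borel) (\<lambda>x f. (of_bool :: bool \<Rightarrow> real) (f x)) {..<n}"
        unfolding M_def
        by (rule prob_space.indep_vars_compose2[OF measure_pmf.prob_space_axioms indep_vars_Pi_pmf]) auto
      then show "indep_vars (\<lambda>_. borel) Y {..<n}" by (simp add: Y_def)
    qed (auto simp: Y_def)
    have "prob {x \<in> space M. (\<Sum>i<n. Y i x) \<le> (\<Sum>i<n. expectation (Y i)) - \<eta> * n}
         \<le> exp (- 2 * (\<eta> * n)\<^sup>2 / (\<Sum>i<n. (1 - 0)\<^sup>2))"
      using H.Hoeffding_ineq_le[of "\<eta> * n"] \<eta> n0 by simp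
    then show ?thesis
      using n0 by (simp add: EY B'_def power2_eq_square field_simps)
  qed
  have B_prob: "prob (B k) \<le> exp (- 2 * \<eta>\<^sup>2 * n)" for k
  proof (cases "L k = {}")
    case True
    \<comment> \<open>Hoeffding's inequality divides by the number of summands, so an empty sum is
      treated apart: it cannot reach the positive deviation \<open>\<eta> * n\<close>.\<close>
    then have "B k = {}" using \<eta> n0 by (auto simp: B_def mult_le_0_iff)
    then show ?thesis by simp
  next
    case False
    have EZ: "(\<Sum>i\<in>L k. expectation (Z k i)) = (\<Sum>i\<in>L k. p i * p (k - i))"
      unfolding Z_def M_def
      by (intro sum.cong refl Pi_pmf_pair_expectation) (use p in \<open>auto simp: L_def\<close>)
    interpret H: Hoeffding_ineq M "L k" "Z k" "\<lambda>_. 0" "\<lambda>_. 1" "\<Sum>i\<in>L k. expectation (Z k i)"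
    proof unfold_locales
      show "indep_vars (\<lambda>_. borel) (Z k) (L k)"
        unfolding Z_def M_def by (rule indep_pairs_Pi_pmf) (auto simp: L_def)
    qed (auto simp: Z_def finL)
    have cL: "0 < card (L k)" "card (L k) \<le> n"
      using False finL card_mono[of "{..<n}" "L k"] by (auto simp: card_gt_0_iff L_def)
    have "prob {x \<in> space M. (\<Sum>i\<in>L k. Z k i x) \<ge> (\<Sum>i\<in>L k. expectation (Z k i)) + \<eta> * n}
         \<le> exp (- 2 * (\<eta> * n)\<^sup>2 / (\<Sum>i\<in>L k. (1 - 0)\<^sup>2))"
      using H.Hoeffding_ineq_ge[of "\<eta> * n"] \<eta> cL by simp
    also have "\<dots> \<le> exp (- 2 * \<eta>\<^sup>2 * n)"
    proof -
      \<comment> \<open>With at most \<open>n\<close> summands the Hoeffding exponent is at least as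
        good as for \<open>n\<close> of them.\<close>
      have "2 * \<eta>\<^sup>2 * n * card (L k) \<le> 2 * \<eta>\<^sup>2 * n * n"
        using cL by (intro mult_left_mono) auto
      then have "2 * \<eta>\<^sup>2 * n \<le> 2 * (\<eta> * n)\<^sup>2 / card (L k)"
        using cL by (simp add: field_simps power2_eq_square)
      then show ?thesis by simp
    qed
    finally show ?thesis by (simp add: EZ B_def)
  qed
  have "prob (B' \<union> (\<Union>k<2*n. B k)) \<le> prob B' + (\<Sum>k<2*n. prob (B k))"
    by (intro order.trans[OF measure_Un_le] add_left_mono measure_UNION_le) auto
  also have "\<dots> \<le> exp (- 2 * \<eta>\<^sup>2 * n) + (\<Sum>k<2*n. exp (- 2 * \<eta>\<^sup>2 * n))"
    by (intro add_mono sum_mono B_prob B'_prob)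
  also have "\<dots> < 1" using n by (simp add: algebra_simps)
  finally have lt: "prob (B' \<union> (\<Union>k<2*n. B k)) < 1" .
  have "\<not> (UNIV \<subseteq> B' \<union> (\<Union>k<2*n. B k))"
  proof
    assume "UNIV \<subseteq> B' \<union> (\<Union>k<2*n. B k)"
    then have "B' \<union> (\<Union>k<2*n. B k) = space M" by auto
    then show False using lt prob_space by simp
  qed
  then obtain \<omega> where \<omega>: "\<omega> \<notin> B'" "\<And>k. k < 2 * n \<Longrightarrow> \<omega> \<notin> B k" by auto
  define S where "S = {i. i < n \<and> \<omega> i}"
  have SY: "(\<Sum>i<n. Y i \<omega>) = card S"
    by (simp add: Y_def S_def sum.If_cases Int_def lessThan_def of_bool_def)
  have rep: "real (card {i\<in>S. i \<le> k \<and> k - i \<in> S}) \<le> c + 2 * \<eta> * n + 1" for k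
  proof (cases "k < 2 * n")
    case True
    have cZ: "(\<Sum>i\<in>L k. Z k i \<omega>) = card {i. i < n \<and> k - i < n \<and> i < k - i \<and> i \<in> S \<and> k - i \<in> S}"
    proof -
      have "(\<Sum>i\<in>L k. Z k i \<omega>) = card {i\<in>L k. \<omega> i \<and> \<omega> (k - i)}"
        by (simp add: Z_def sum.If_cases finL Int_def of_bool_def)
      also have "{i\<in>L k. \<omega> i \<and> \<omega> (k - i)} = {i. i < n \<and> k - i < n \<and> i < k - i \<and> i \<in> S \<and> k - i \<in> S}"
        by (auto simp: L_def S_def)
      finally show ?thesis .
    qed
    \<comment> \<open>Both members of every mirror pair occur in the full sum, so \<open>L k\<close>
      carries at most half of it.\<close>
    have two: "2 * (\<Sum>i\<in>L k. p i * p (k - i)) \<le> c"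
    proof -
      have "2 * (\<Sum>i\<in>L k. p i * p (k - i))
          = (\<Sum>i\<in>L k. p i * p (k - i)) + (\<Sum>i\<in>(\<lambda>i. k - i) ` L k. p i * p (k - i))"
        by (subst sum.reindex) (auto simp: inj_on_def L_def mult.commute intro!: sum.cong)
      also have "\<dots> = (\<Sum>i\<in>L k \<union> (\<lambda>i. k - i) ` L k. p i * p (k - i))"
        by (rule sum.union_disjoint[symmetric]) (auto simp: L_def)
      also have "\<dots> \<le> (\<Sum>i | i < n \<and> i \<le> k \<and> k - i < n. p i * p (k - i))"
        by (rule sum_mono2) (use p in \<open>auto simp: L_def\<close>)
      also have "\<dots> \<le> c" by (rule c)
      finally show ?thesis .
    qed
    have "real (card {i\<in>S. i \<le> k \<and> k - i \<in> S}) \<le> 2 * (\<Sum>i\<in>L k. Z k i \<omega>) + 1"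
      unfolding cZ using card_sum_rep_le[of S n k] by (simp add: S_def subset_eq)
    also have "\<dots> \<le> c + 2 * \<eta> * n + 1"
      using \<omega>(2)[OF True] two by (simp add: B_def)
    finally show ?thesis .
  next
    case False
    \<comment> \<open>Two elements below \<open>n\<close> have sum below \<open>2 * n\<close>, which
      is why the union bound stops there.\<close>
    then have "{i\<in>S. i \<le> k \<and> k - i \<in> S} = {}" by (auto simp: S_def)
    moreover have "0 \<le> c" using c[of "2*n"] n0 
      by (meson order.trans p sum_nonneg mult_nonneg_nonneg)
    ultimately show ?thesis using \<eta> by (simp only: card.empty) simp
  qed
  show ?thesis
  proof (rule that)
    show "S \<subseteq> {..<n}" by (auto simp: S_def)
    show "real (card S) \<ge> (\<Sum>i<n. p i) - \<eta> * n" using \<omega>(1) SY by (simp add: B'_def)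
  qed (rule rep)
qed

lemma eventually_Hoeffding_union_bound:
  assumes "0 < (\<eta>::real)"
  shows "\<forall>\<^sub>F n in sequentially. (2 * real n + 1) * exp (- 2 * \<eta>\<^sup>2 * real n) < 1"
  using assms by real_asymp

subsection \<open>Overlaps of a set with its reflections\<close>

lemma sets_lebesgue_reflect [measurable]:
  fixes A :: "real set"
  assumes "A \<in> sets lebesgue"
  shows "{y. c - y \<in> A} \<in> sets lebesgue"
proof -
  have "(\<lambda>y. c + (-1) * y) -` A \<inter> space lebesgue \<in> sets lebesgue"
    by (rule measurable_sets[OF _ assms]) (use lebesgue_affine_measurable[of "\<lambda>_::real. -1" c] in simp)
  then show ?thesis by (simp add: vimage_def)
qed

lemma emeasure_lebesgue_reflect:
  fixes A :: "real set"
  assumes [measurable]: "A \<in> sets lebesgue"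
  shows "emeasure lebesgue {y. c - y \<in> A} = emeasure lebesgue A"
proof -
  have "emeasure lebesgue A = (\<integral>\<^sup>+x. indicator A x \<partial>lebesgue)" by simp
  also have "\<dots> = ennreal \<bar>-1\<bar> * (\<integral>\<^sup>+x. indicator A (c + (-1) * x) \<partial>lebesgue)"
    by (rule nn_integral_real_affine_lebesgue) auto
  also have "\<dots> = (\<integral>\<^sup>+x. indicator {y. c - y \<in> A} x \<partial>lebesgue)"
    by (simp add: indicator_def del: nn_integral_indicator)
  also have "\<dots> = emeasure lebesgue {y. c - y \<in> A}"
    by (rule nn_integral_indicator[OF sets_lebesgue_reflect[OF assms]])
  finally show ?thesis by (rule sym)
qed

text \<open>The largest subset of \<open>A\<close> symmetric about \<open>c / 2\<close>. Indexing by
  \<open>c\<close>, twice the centre, makes its measure the autoconvolution at \<open>c\<close> of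
  the indicator of \<open>A\<close>.\<close>

definition self_overlap :: "real set \<Rightarrow> real \<Rightarrow> real set" where
  "self_overlap A c = {y \<in> A. c - y \<in> A}"

lemma self_overlap_sets [measurable]:
  "A \<in> sets lebesgue \<Longrightarrow> self_overlap A c \<in> sets lebesgue"
  using sets.Int[OF _ sets_lebesgue_reflect[of A c], of A] by (simp add: self_overlap_def Int_def)

lemma lmeasurable_subset_unit:
  fixes A :: "real set"
  assumes "A \<in> sets lebesgue" "A \<subseteq> {0..<1}"
  shows "A \<in> lmeasurable"
  using assms bounded_subset[OF bounded_closed_interval[of 0 "1::real"], of A]
  by (intro bounded_set_imp_lmeasurable) force+

lemma measure_subset_unit_le:
  fixes A :: "real set"
  assumes "A \<in> sets lebesgue" "A \<subseteq> {0..<1}"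
  shows "measure lebesgue A \<le> 1"
  using measure_mono_fmeasurable[OF assms(2,1) lmeasurable_subset_unit[of "{0..<1}"]] by simp

lemma self_overlap_subset: "self_overlap A c \<subseteq> A"
  by (auto simp: self_overlap_def)

lemma self_overlap_lmeasurable:
  assumes "A \<in> sets lebesgue" "A \<subseteq> {0..<1}"
  shows "self_overlap A c \<in> lmeasurable"
  using assms self_overlap_subset by (intro lmeasurable_subset_unit self_overlap_sets) blast+

lemma symmetric_self_overlap: "symmetric_set (self_overlap A c)"
  unfolding symmetric_set_def self_overlap_def
  by (rule exI[of _ "c/2"]) (auto simp: algebra_simps)

lemma bdd_above_symmetric_measures:
  assumes "A \<subseteq> {0..<1}"
  shows "bdd_above {measure lebesgue C | C. C \<subseteq> A \<and> C \<in> sets lebesgue \<and> symmetric_set C}"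
  by (rule bdd_aboveI[of _ 1]) (use assms measure_subset_unit_le in blast)

lemma self_overlap_le_D:
  assumes "A \<in> sets lebesgue" "A \<subseteq> {0..<1}"
  shows "measure lebesgue (self_overlap A c) \<le> D A"
  unfolding D_def
  by (rule cSup_upper[OF _ bdd_above_symmetric_measures[OF assms(2)]])
     (use assms symmetric_self_overlap self_overlap_subset self_overlap_sets in blast)

text \<open>A symmetric subset of \<open>A\<close> with centre \<open>c\<close> lies in
  \<open>self_overlap A (2 * c)\<close>, so the overlaps are the only competitors that
  matter.\<close>

lemma D_leI:
  assumes "A \<in> sets lebesgue" "A \<subseteq> {0..<1}"
    and le: "\<And>c. measure lebesgue (self_overlap A c) \<le> d"
  shows "D A \<le> d"
  unfolding D_def
proof (rule cSup_least)
  have "symmetric_set {}" by (simp add: symmetric_set_def)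
  then show "{measure lebesgue C | C. C \<subseteq> A \<and> C \<in> sets lebesgue \<and> symmetric_set C} \<noteq> {}"
    by blast
next
  fix m assume "m \<in> {measure lebesgue C | C. C \<subseteq> A \<and> C \<in> sets lebesgue \<and> symmetric_set C}"
  then obtain C c where C: "m = measure lebesgue C" "C \<subseteq> A" "C \<in> sets lebesgue"
    "\<And>x. c + x \<in> C \<longleftrightarrow> c - x \<in> C" unfolding symmetric_set_def by blast
  have "C \<subseteq> self_overlap A (2 * c)"
  proof
    fix y assume "y \<in> C"
    then have "2 * c - y \<in> C" using C(4)[of "y - c"] by (simp add: algebra_simps)
    with \<open>y \<in> C\<close> C(2) show "y \<in> self_overlap A (2 * c)" by (auto simp: self_overlap_def)
  qed
  moreover have "self_overlap A (2 * c) \<in> lmeasurable"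
    by (rule self_overlap_lmeasurable) fact+
  ultimately have "m \<le> measure lebesgue (self_overlap A (2 * c))"
    using C by (simp add: measure_mono_fmeasurable)
  with le show "m \<le> d" by (rule order_trans[rotated])
qed

text \<open>A point of the new overlap outside the old one lies in \<open>B\<close> or has its
  mirror image there; each of the two sets has the measure of \<open>B\<close>.\<close>

lemma self_overlap_Un_le:
  assumes "A \<in> sets lebesgue" "A \<subseteq> {0..<1}" "B \<in> sets lebesgue" "B \<subseteq> {0..<1}"
  shows "measure lebesgue (self_overlap (A \<union> B) c)
       \<le> measure lebesgue (self_overlap A c) + 2 * measure lebesgue B"
proof -
  let ?R = "{y. c - y \<in> B}"
  have mA: "self_overlap A c \<in> lmeasurable"
    by (rule self_overlap_lmeasurable) fact+
  have mB: "B \<in> lmeasurable" by (rule lmeasurable_subset_unit) (use assms in auto)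
  have eR: "emeasure lebesgue ?R = emeasure lebesgue B" by (rule emeasure_lebesgue_reflect) fact
  then have mR: "?R \<in> lmeasurable" 
    using mB assms(3) by (simp add: fmeasurable_def sets_lebesgue_reflect)
  have "measure lebesgue (self_overlap (A \<union> B) c) \<le> measure lebesgue (self_overlap A c \<union> (B \<union> ?R))"
    using assms mA mB mR
    by (intro measure_mono_fmeasurable self_overlap_sets sets.Un fmeasurable.Un) (auto simp: self_overlap_def)
  also have "\<dots> \<le> measure lebesgue (self_overlap A c) + (measure lebesgue B + measure lebesgue ?R)"
    by (intro order.trans[OF measure_Un_le] add_left_mono measure_Un_le fmeasurableD mA mB mR fmeasurable.Un)
  also have "measure lebesgue ?R = measure lebesgue B" using eR by (simp add: measure_def)
  finally show ?thesis by simp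
qed

text \<open>The measure of \<open>A \<inter> {0..<t}\<close> is 1-Lipschitz in \<open>t\<close> and
  runs from 0 to the measure of \<open>A\<close>, so it takes the value \<open>e\<close>.\<close>

lemma exists_subset_of_measure:
  fixes A :: "real set"
  assumes "A \<in> sets lebesgue" "A \<subseteq> {0..<1}" "0 \<le> e" "e \<le> measure lebesgue A"
  shows "\<exists>B. B \<in> sets lebesgue \<and> B \<subseteq> A \<and> measure lebesgue B = e"
proof -
  define F where "F t = measure lebesgue (A \<inter> {0..<t})" for t
  have mF: "A \<inter> {0..<t} \<in> lmeasurable" for t
    by (rule lmeasurable_subset_unit) (use assms in auto)
  have inc: "F s \<le> F t" "F t \<le> F s + (t - s)" if "s \<le> t" for s t
  proof -
    show "F s \<le> F t" unfolding F_def
      by (rule measure_mono_fmeasurable) (use that mF in auto)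
    have "F t \<le> measure lebesgue ((A \<inter> {0..<s}) \<union> {s..t})" unfolding F_def
      by (rule measure_mono_fmeasurable) (use mF in \<open>auto intro!: fmeasurable.Un\<close>)
    also have "\<dots> \<le> F s + measure lebesgue {s..t}" unfolding F_def
      by (rule measure_Un_le) (use mF in auto)
    finally show "F t \<le> F s + (t - s)" using that by simp
  qed
  have "1-lipschitz_on {0..1} F"
  proof (rule lipschitz_onI)
    fix s t :: real
    show "dist (F s) (F t) \<le> 1 * dist s t"
      using inc[of s t] inc[of t s] by (cases "s \<le> t") (auto simp: dist_real_def abs_le_iff)
  qed simp
  then have "continuous_on {0..1} F" by (rule lipschitz_on_continuous_on)
  moreover have "A \<inter> {0..<1} = A" using assms by auto
  ultimately obtain t where "F t = e" 
    using IVT'[of F 0 e 1] assms by (auto simp: F_def)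
  then show ?thesis
    using mF by (intro exI[of _ "A \<inter> {0..<t}"]) (auto simp: F_def)
qed

section \<open>From \<open>D\<close> to \<open>Delta\<close>\<close>

lemma Delta_le_D:
  assumes "A \<in> sets lebesgue" "A \<subseteq> {0..<1}"
  shows "Delta (measure lebesgue A) \<le> D A"
  unfolding Delta_def
proof (rule cInf_lower)
  show "bdd_below {D B | B. B \<in> sets lebesgue \<and> B \<subseteq> {0..<1} \<and> measure lebesgue B = measure lebesgue A}"
  proof (rule bdd_belowI[of _ 0])
    fix d assume "d \<in> {D B | B. B \<in> sets lebesgue \<and> B \<subseteq> {0..<1} \<and> measure lebesgue B = measure lebesgue A}"
    then obtain B where "d = D B" "B \<in> sets lebesgue" "B \<subseteq> {0..<1}" by blast
    then show "0 \<le> d" using order_trans[OF measure_nonneg self_overlap_le_D] by blast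
  qed
qed (use assms in blast)

lemma Delta_geI:
  assumes "0 \<le> e" "e \<le> 1"
    and "\<And>A. A \<in> sets lebesgue \<Longrightarrow> A \<subseteq> {0..<1} \<Longrightarrow> measure lebesgue A = e \<Longrightarrow> d \<le> D A"
  shows "d \<le> Delta e"
  unfolding Delta_def
proof (rule cInf_greatest)
  have "{0..<e} \<in> sets lebesgue \<and> {0..<e} \<subseteq> {0..<1} \<and> measure lebesgue {0..<e} = e"
    using assms by auto
  then show "{D A | A. A \<in> sets lebesgue \<and> A \<subseteq> {0..<1} \<and> measure lebesgue A = e} \<noteq> {}" by blast
qed (use assms in blast)

text \<open>A set of roughly the right measure suffices: one too large is cut down, which cannot
  increase \<open>D\<close>; one too small is filled up inside the unit interval, at a cost of twice
  the added measure.\<close>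

lemma Delta_le_adjust:
  assumes A: "A \<in> sets lebesgue" "A \<subseteq> {0..<1}" and e: "0 \<le> e" "e \<le> 1"
  shows "Delta e \<le> D A + 2 * max 0 (e - measure lebesgue A)"
proof (cases "e \<le> measure lebesgue A")
  case True
  obtain B where B: "B \<in> sets lebesgue" "B \<subseteq> A" "measure lebesgue B = e"
    using exists_subset_of_measure[OF A e(1) True] by blast
  have "D B \<le> D A"
  proof (rule D_leI)
    fix c
    have "measure lebesgue (self_overlap B c) \<le> measure lebesgue (self_overlap A c)"
      using A B by (intro measure_mono_fmeasurable self_overlap_sets self_overlap_lmeasurable)
        (auto simp: self_overlap_def)
    then show "measure lebesgue (self_overlap B c) \<le> D A"
      using self_overlap_le_D[OF A] order_trans by blast
  qed (use A B in auto)
  moreover have "Delta e \<le> D B" using Delta_le_D[of B] A B by auto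
  ultimately show ?thesis using True by simp
next
  case False
  have compl: "measure lebesgue ({0..<1} - A) = 1 - measure lebesgue A"
    by (subst measurable_measure_Diff) (use A lmeasurable_subset_unit[of "{0..<1}"] in auto)
  have sets: "{0..<1} - A \<in> sets lebesgue" using A by auto
  have le: "0 \<le> e - measure lebesgue A" "e - measure lebesgue A \<le> measure lebesgue ({0..<1} - A)"
    using False e compl by auto
  obtain B where B: "B \<in> sets lebesgue" "B \<subseteq> {0..<1} - A" "measure lebesgue B = e - measure lebesgue A"
    using exists_subset_of_measure[OF sets Diff_subset le] by blast
  have meas: "measure lebesgue (A \<union> B) = e"
  proof -
    have "A \<inter> B = {}" using B by blast
    moreover have "A \<in> lmeasurable" using A by (rule lmeasurable_subset_unit)
    moreover have "B \<in> lmeasurable" using B by (intro lmeasurable_subset_unit) blast+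
    ultimately show ?thesis using B by (simp add: measure_Un3)
  qed
  have B': "B \<subseteq> {0..<1}" using B by blast
  have "D (A \<union> B) \<le> D A + 2 * (e - measure lebesgue A)"
  proof (rule D_leI)
    fix c show "measure lebesgue (self_overlap (A \<union> B) c) \<le> D A + 2 * (e - measure lebesgue A)"
      unfolding B(3)[symmetric]
      using self_overlap_Un_le[OF A B(1) B', of c] self_overlap_le_D[OF A, of c] by linarith
  qed (use A B(1) B' in auto)
  moreover have "Delta e \<le> D (A \<union> B)"
    unfolding meas[symmetric] by (rule Delta_le_D) (use A B(1) B' in auto)
  ultimately show ?thesis using False by simp
qed

subsection \<open>From step functions to sets\<close>

definition cells :: "nat \<Rightarrow> nat set \<Rightarrow> real set" where
  "cells n S = (\<Union>i\<in>S. {real i / n ..< (real i + 1) / n})"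

lemma indicator_cells:
  assumes "finite S" "0 < n"
  shows "indicator (cells n S) y = (\<Sum>i\<in>S. indicator {real i / n ..< (real i + 1) / n} y :: ennreal)"
proof -
  have "disjoint_family_on (\<lambda>i. {real i / n ..< (real i + 1) / n}) S"
    unfolding disjoint_family_on_def
  proof (intro ballI impI)
    fix i j :: nat assume "i \<noteq> j"
    then have "real i + 1 \<le> real j \<or> real j + 1 \<le> real i" by linarith
    then have "(real i + 1) / n \<le> real j / n \<or> (real j + 1) / n \<le> real i / n"
      using assms(2) by (simp add: divide_le_cancel)
    then show "{real i / n ..< (real i + 1) / n} \<inter> {real j / n ..< (real j + 1) / n} = {}" by auto
  qed
  then show ?thesis
    unfolding cells_def using assms(1) by (rule indicator_UN_disjoint[rotated])
qed

lemma borel_cells [measurable]: "finite S \<Longrightarrow> cells n S \<in> sets borel"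
  by (simp add: cells_def)

text \<open>The condition \<open>0 \<le> y\<close> is there because \<open>nat\<close> sends
  negative floors to 0, which may lie in \<open>S\<close>.\<close>

lemma mem_cells_iff:
  assumes "0 < n"
  shows "y \<in> cells n S \<longleftrightarrow> 0 \<le> y \<and> nat \<lfloor>n * y\<rfloor> \<in> S"
proof -
  have "y \<in> {real i / n ..< (real i + 1) / n} \<longleftrightarrow> 0 \<le> y \<and> nat \<lfloor>n * y\<rfloor> = i" for i
  proof -
    have "y \<in> {real i / n ..< (real i + 1) / n} \<longleftrightarrow> \<lfloor>n * y\<rfloor> = int i"
      using assms by (simp add: floor_eq_iff field_simps)
    also have "\<dots> \<longleftrightarrow> 0 \<le> y \<and> nat \<lfloor>n * y\<rfloor> = i"
    proof (cases "y < 0")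
      case True
      then have "\<lfloor>n * y\<rfloor> < 0" using assms by (simp add: mult_pos_neg)
      then have "\<lfloor>n * y\<rfloor> \<noteq> int i" by linarith
      then show ?thesis using True by simp
    next
      case False
      then have "0 \<le> \<lfloor>n * y\<rfloor>" by simp
      then show ?thesis using False by auto
    qed
    finally show ?thesis .
  qed
  then show ?thesis by (auto simp: cells_def)
qed

lemma cells_subset_unit:
  assumes "S \<subseteq> {..<n}" "0 < n"
  shows "cells n S \<subseteq> {0..<1}"
proof
  fix y assume "y \<in> cells n S"
  then have "0 \<le> y" "nat \<lfloor>n * y\<rfloor> < n" using assms mem_cells_iff by auto
  then have "n * y < n" by linarith
  then show "y \<in> {0..<1}" using \<open>0 \<le> y\<close> assms by simp
qed

lemma measure_cells:
  assumes "finite S" "0 < n"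
  shows "measure lebesgue (cells n S) = card S / n"
proof -
  have len: "emeasure lborel {real i / n ..< (real i + 1) / n} = ennreal (1 / n)" for i
  proof -
    have "(real i + 1) / n - real i / n = 1 / n" by (simp add: add_divide_distrib)
    then show ?thesis using assms by (simp add: divide_right_mono)
  qed
  have "emeasure lborel (cells n S) = (\<integral>\<^sup>+y. indicator (cells n S) y \<partial>lborel)"
    using assms by simp
  also have "\<dots> = (\<integral>\<^sup>+y. (\<Sum>i\<in>S. indicator {real i / n ..< (real i + 1) / n} y) \<partial>lborel)"
    by (rule nn_integral_cong) (rule indicator_cells[OF assms])
  also have "\<dots> = (\<Sum>i\<in>S. emeasure lborel {real i / n ..< (real i + 1) / n})"
    by (simp add: nn_integral_sum)
  also have "\<dots> = ennreal (card S / n)"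
    by (simp add: len ennreal_of_nat_eq_real_of_nat flip: ennreal_mult)
  finally show ?thesis using assms by (simp add: measure_def)
qed

text \<open>Write the points of cell \<open>i\<close> as \<open>(i + u) / n\<close> with offset
  \<open>u\<close> in the unit interval. For fixed \<open>u\<close>, a mirror image that lies in
  \<open>cells n S\<close> lies in cell \<open>k - i\<close> with
  \<open>k = \<lfloor>n * c - u\<rfloor>\<close>, so at most \<open>g\<close> indices
  \<open>i\<close> contribute. Integrating over \<open>u\<close> and scaling by \<open>1 / n\<close>
  gives the bound.\<close>

lemma D_cells_le:
  assumes S: "S \<subseteq> {..<n}" "0 < n" and g: "\<And>k. real (card {i\<in>S. i \<le> k \<and> k - i \<in> S}) \<le> g"
  shows "D (cells n S) \<le> g / n"
proof (rule D_leI)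
  have fin: "finite S" using S finite_subset by blast
  have [measurable]: "cells n S \<in> sets borel" using fin by (rule borel_cells)
  have g0: "0 \<le> g" using g[of 0] by linarith
  fix c
  let ?I = "\<lambda>i. {real i / n ..< (real i + 1) / n}"
  have count: "(\<Sum>i\<in>S. indicator (?I i) ((real i + u) / n) * indicator (cells n S) (c - (real i + u) / n) :: ennreal)
      \<le> ennreal g * indicator {0..<1} u" for u :: real
  proof (cases "u \<in> {0..<1}")
    case False
    then have "indicator (?I i) ((real i + u) / n) = (0::ennreal)" for i
      using S by (auto simp: indicator_def divide_le_cancel divide_less_cancel)
    then show ?thesis by simp
  next
    case True
    let ?k = "nat \<lfloor>n * c - u\<rfloor>"
    have *: "c - (real i + u) / n \<in> cells n S \<Longrightarrow> i \<le> ?k \<and> ?k - i \<in> S" for i :: nat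
    proof -
      assume "c - (real i + u) / n \<in> cells n S"
      then have A: "0 \<le> c - (real i + u) / n" "nat \<lfloor>n * (c - (real i + u) / n)\<rfloor> \<in> S"
        using S mem_cells_iff by auto
      have eq: "n * (c - (real i + u) / n) = (n * c - u) - of_nat i" using S by (simp add: field_simps)
      \<comment> \<open>Nonnegativity yields \<open>i \<le> ?k\<close>, so that the truncated
        difference \<open>?k - i\<close> is the true one.\<close>
      have "0 \<le> (n * c - u) - of_nat i" using A(1) S by (simp flip: eq)
      then have "int i \<le> \<lfloor>n * c - u\<rfloor>" by (simp add: le_floor_iff)
      moreover have "\<lfloor>n * (c - (real i + u) / n)\<rfloor> = \<lfloor>n * c - u\<rfloor> - int i"
        unfolding eq by linarith
      ultimately show ?thesis using A(2) by (simp add: nat_diff_distrib le_nat_iff)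
    qed
    have "(\<Sum>i\<in>S. indicator (?I i) ((real i + u) / n) * indicator (cells n S) (c - (real i + u) / n) :: ennreal)
      \<le> (\<Sum>i\<in>S. of_bool (i \<le> ?k \<and> ?k - i \<in> S))"
      by (intro sum_mono) (use * in \<open>auto simp: indicator_def\<close>)
    also have "\<dots> = of_nat (card {i\<in>S. i \<le> ?k \<and> ?k - i \<in> S})"
      using fin by (simp add: of_bool_def sum.If_cases Int_def)
    also have "\<dots> \<le> ennreal g"
      using g[of ?k] g0 by (simp add: ennreal_of_nat_eq_real_of_nat ennreal_leI)
    finally show ?thesis using True by simp
  qed
  have "emeasure lborel (self_overlap (cells n S) c)
      = (\<integral>\<^sup>+y. indicator (self_overlap (cells n S) c) y \<partial>lborel)"
    by (rule nn_integral_indicator[symmetric]) (simp add: self_overlap_def)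
  also have "\<dots> = (\<integral>\<^sup>+y. (\<Sum>i\<in>S. indicator (?I i) y * indicator (cells n S) (c - y)) \<partial>lborel)"
  proof (rule nn_integral_cong)
    fix y
    have "indicator (self_overlap (cells n S) c) y = indicator (cells n S) y * (indicator (cells n S) (c - y) :: ennreal)"
      by (simp add: self_overlap_def indicator_def)
    then show "indicator (self_overlap (cells n S) c) y
        = (\<Sum>i\<in>S. indicator (?I i) y * indicator (cells n S) (c - y) :: ennreal)"
      by (simp only: indicator_cells[OF fin S(2), of y] sum_distrib_right)
  qed
  also have "\<dots> = (\<Sum>i\<in>S. \<integral>\<^sup>+y. indicator (?I i) y * indicator (cells n S) (c - y) \<partial>lborel)"
    by (rule nn_integral_sum) simp
  also have "\<dots> = (\<Sum>i\<in>S. ennreal (1 / n) *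
      (\<integral>\<^sup>+u. indicator (?I i) ((real i + u) / n) * indicator (cells n S) (c - (real i + u) / n) \<partial>lborel))"
  proof (rule sum.cong[OF refl])
    fix i
    show "(\<integral>\<^sup>+y. indicator (?I i) y * indicator (cells n S) (c - y) \<partial>lborel) = ennreal (1 / n) *
      (\<integral>\<^sup>+u. indicator (?I i) ((real i + u) / n) * indicator (cells n S) (c - (real i + u) / n) \<partial>lborel)"
      by (subst nn_integral_real_affine[where c = "1 / n" and t = "i / n"])
         (use S in \<open>auto simp: add_divide_distrib\<close>)
  qed
  also have "\<dots> = ennreal (1 / n) *
      (\<integral>\<^sup>+u. (\<Sum>i\<in>S. indicator (?I i) ((real i + u) / n) * indicator (cells n S) (c - (real i + u) / n)) \<partial>lborel)"
    by (subst nn_integral_sum) (auto simp: sum_distrib_left)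
  also have "\<dots> \<le> ennreal (1 / n) * (\<integral>\<^sup>+u. ennreal g * indicator {0..<1::real} u \<partial>lborel)"
    by (intro mult_left_mono nn_integral_mono count) auto
  also have "\<dots> = ennreal (g / n)"
    using g0 by (simp add: nn_integral_cmult flip: ennreal_mult)
  finally have "measure lborel (self_overlap (cells n S) c) \<le> g / n"
    using g0 by (simp add: measure_def enn2real_leI)
  moreover have "self_overlap (cells n S) c \<in> sets borel" by (simp add: self_overlap_def)
  ultimately show "measure lebesgue (self_overlap (cells n S) c) \<le> g / n" by simp
next
  show "cells n S \<in> sets lebesgue"
    using borel_cells[OF finite_subset[OF S(1)]] by auto
qed (rule cells_subset_unit[OF S])

text \<open>Transfers bounds from functions to sets. Asking only for infinitely many
  \<open>n\<close> allows profiles tied to multiples of a number; the slack 1 in the mean vanishes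
  after division by \<open>n\<close>.\<close>

lemma Delta_le_of_profiles:
  fixes e G :: real
  assumes e: "0 \<le> e" "e \<le> 1" and prof: "\<exists>\<^sub>F n in sequentially. \<exists>p :: nat \<Rightarrow> real. (\<forall>i. 0 \<le> p i \<and> p i \<le> 1)
     \<and> n * e - 1 \<le> (\<Sum>i<n. p i)
     \<and> (\<forall>k. (\<Sum>i | i < n \<and> i \<le> k \<and> k - i < n. p i * p (k - i)) \<le> n * G)"
  shows "Delta e \<le> G"
proof (rule field_le_epsilon)
  fix \<delta> :: real assume \<delta>: "0 < \<delta>"
  \<comment> \<open>The losses are \<open>2 * \<eta> + 1 / n\<close> in \<open>D\<close> and twice
    \<open>\<eta> + 1 / n\<close> for the missing measure. With \<open>6 / \<delta> < n\<close>,
    both \<open>4 * \<eta>\<close> and \<open>3 / n\<close> are at most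
    \<open>\<delta> / 2\<close>.\<close>
  define \<eta> where "\<eta> = \<delta> / 8"
  have \<eta>: "0 < \<eta>" using \<delta> by (simp add: \<eta>_def)
  have "\<forall>\<^sub>F n in sequentially. 6 / \<delta> < real n"
    using filterlim_real_sequentially filterlim_at_top_dense by blast
  then have "\<forall>\<^sub>F n in sequentially. 6 / \<delta> < real n \<and> (2 * real n + 1) * exp (- 2 * \<eta>\<^sup>2 * real n) < 1"
    using eventually_Hoeffding_union_bound[OF \<eta>] by (rule eventually_conj)
  from frequently_eventually_conj[OF prof this, THEN frequently_ex]
  obtain n p where n: "6 / \<delta> < real n" "(2 * real n + 1) * exp (- 2 * \<eta>\<^sup>2 * real n) < 1"
    and p: "\<And>i. 0 \<le> p i \<and> p i \<le> 1" "n * e - 1 \<le> (\<Sum>i<n. p i)"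
      "\<And>k. (\<Sum>i | i < n \<and> i \<le> k \<and> k - i < n. p i * p (k - i)) \<le> n * G"
    by blast
  have n0: "0 < n" using n(2) by (cases n) auto
  obtain S where S: "S \<subseteq> {..<n}" "real (card S) \<ge> (\<Sum>i<n. p i) - \<eta> * n"
    "\<And>k. real (card {i\<in>S. i \<le> k \<and> k - i \<in> S}) \<le> n * G + 2 * \<eta> * n + 1"
    using random_set_few_representations[OF \<eta> n(2) p(1) p(3)] by blast
  have fin: "finite S" using S(1) finite_subset by blast
  have "(n * e - 1 - \<eta> * n) / n \<le> card S / n"
    using S(2) p(2) by (intro divide_right_mono) auto
  then have "e - 1 / n - \<eta> \<le> measure lebesgue (cells n S)"
    using n0 by (simp add: measure_cells[OF fin n0] diff_divide_distrib)
  then have "max 0 (e - measure lebesgue (cells n S)) \<le> 1 / n + \<eta>"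
    using \<eta> by simp
  moreover have "Delta e \<le> D (cells n S) + 2 * max 0 (e - measure lebesgue (cells n S))"
    by (rule Delta_le_adjust[OF _ cells_subset_unit[OF S(1) n0] e]) (use fin in auto)
  moreover have "3 / real n = 3 * (1 / n)" by simp
  moreover have "D (cells n S) \<le> G + 2 * \<eta> + 1 / n"
    using D_cells_le[OF S(1) n0 S(3)] n0 by (simp add: add_divide_distrib)
  ultimately have "Delta e \<le> G + 4 * \<eta> + 3 / n" by argo
  also have "3 / n \<le> \<delta> / 2" using n(1) n0 \<delta> by (simp add: field_simps)
  finally show "Delta e \<le> G + \<delta>" by (simp add: \<eta>_def)
qed

subsection \<open>Upper bounds\<close>

text \<open>A step function on eight cells, attaining the bound 2 e - 1 at e = 11/16: in each pair of
  mirror cells i and 7 - i at least one value is 1.\<close>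
definition witness_step :: "nat \<Rightarrow> real" where
  "witness_step a = (if a \<in> {0, 3, 5, 6, 7} then 1 else if a = 2 then 1/2 else 0)"

lemma witness_step_bounds: "0 \<le> witness_step a \<and> witness_step a \<le> 1"
  by (simp add: witness_step_def)

lemma witness_step_sum: "(\<Sum>a<8. witness_step a) = 11/2"
  by (simp add: witness_step_def eval_nat_numeral)

text \<open>Both indices are at most 7, so only the sums up to 14 have to be computed. On eight
  cells the value 3 amounts to 3/8, which is twice 11/16 minus 1.\<close>

lemma witness_step_conv: "(\<Sum>a\<le>k. witness_step a * witness_step (k - a)) \<le> 3"
proof (cases "k \<le> 14")
  case True
  then have "k \<in> set [0..<15]" by simp
  then show ?thesis by (auto simp: witness_step_def eval_nat_numeral)
next
  case False
  then have "witness_step a * witness_step (k - a) = 0" if "a \<le> k" for a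
    using that by (cases "a \<le> 7") (auto simp: witness_step_def)
  then have "(\<Sum>a\<le>k. witness_step a * witness_step (k - a)) = 0" by (intro sum.neutral) simp
  then show ?thesis by simp
qed

text \<open>Writing an index as \<open>a * m + u\<close> separates block \<open>a\<close> from
  offset \<open>u\<close>, so that the convolution of a blockwise constant profile can be bounded
  for each offset separately.\<close>

lemma sum_blocks:
  fixes f :: "nat \<Rightarrow> 'a :: comm_monoid_add"
  shows "(\<Sum>i<l * m. f i) = (\<Sum>u<m. \<Sum>a<l. f (a * m + u))"
proof -
  have "(\<Sum>i<l * m. f i) = (\<Sum>a<l. sum f {a * m..<a * m + m})"
    by (rule sum.nat_group[symmetric])
  also have "\<dots> = (\<Sum>a<l. \<Sum>u<m. f (a * m + u))"
  proof (rule sum.cong[OF refl])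
    fix a
    show "sum f {a * m..<a * m + m} = (\<Sum>u<m. f (a * m + u))"
      by (rule sum.reindex_bij_witness[of _ "\<lambda>u. a * m + u" "\<lambda>i. i - a * m"]) auto
  qed
  also have "\<dots> = (\<Sum>u<m. \<Sum>a<l. f (a * m + u))" by (rule sum.swap)
  finally show ?thesis .
qed

lemma Delta_le_square_of_le_11_16:
  assumes \<epsilon>: "0 < \<epsilon>" "\<epsilon> \<le> 11/16"
  shows "Delta \<epsilon> \<le> 96/121 * \<epsilon>\<^sup>2"
proof (rule Delta_le_of_profiles)
  \<comment> \<open>Scales the witness from mean 11/16 to mean \<open>\<epsilon>\<close>. The
    assumption \<open>\<epsilon> \<le> 11/16\<close> gives \<open>h \<le> 1\<close>, and the bound
    becomes \<open>h\<^sup>2 * 3/8 = 96/121 * \<epsilon>\<^sup>2\<close>.\<close>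
  define h where "h = 16 * \<epsilon> / 11"
  have h: "0 \<le> h" "h \<le> 1" using \<epsilon> by (auto simp: h_def)
  show "\<exists>\<^sub>F n in sequentially. \<exists>p. (\<forall>i. 0 \<le> p i \<and> p i \<le> 1)
     \<and> n * \<epsilon> - 1 \<le> (\<Sum>i<n. p i)
     \<and> (\<forall>k. (\<Sum>i | i < n \<and> i \<le> k \<and> k - i < n. p i * p (k - i)) \<le> n * (96/121 * \<epsilon>\<^sup>2))"
    unfolding frequently_sequentially
  proof
    fix N :: nat
    define m where "m = Suc N"
    have m: "0 < m" by (simp add: m_def)
    define p where "p i = h * witness_step (i div m)" for i
    have "(\<Sum>i<8 * m. p i) = h * (\<Sum>u<m. \<Sum>a<8. witness_step a)"
      unfolding sum_blocks by (simp add: p_def sum_distrib_left mult.left_commute)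
    then have sum: "(\<Sum>i<8 * m. p i) = real (8 * m) * \<epsilon>"
      by (simp add: witness_step_sum h_def)
    have conv: "(\<Sum>i | i < 8 * m \<and> i \<le> k \<and> k - i < 8 * m. p i * p (k - i)) \<le> real (8 * m) * (96/121 * \<epsilon>\<^sup>2)" for k
    proof -
      \<comment> \<open>The cut-off at \<open>i \<le> k\<close> prevents spurious terms from
        truncated subtraction when the sum is extended to all \<open>i < 8 * m\<close>.\<close>
      define f where "f i = (if i \<le> k then witness_step (i div m) * witness_step ((k - i) div m) else 0)" for i
      have "(\<Sum>i | i < 8 * m \<and> i \<le> k \<and> k - i < 8 * m. p i * p (k - i))
          = h\<^sup>2 * (\<Sum>i | i < 8 * m \<and> i \<le> k \<and> k - i < 8 * m. f i)"
        unfolding sum_distrib_left by (rule sum.cong) (auto simp: p_def f_def power2_eq_square)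
      also have "\<dots> \<le> h\<^sup>2 * (\<Sum>i<8 * m. f i)"
        by (intro mult_left_mono sum_mono2) (auto simp: f_def witness_step_bounds)
      also have "(\<Sum>i<8 * m. f i) = (\<Sum>u<m. \<Sum>a<8. f (a * m + u))" by (rule sum_blocks)
      also have "\<dots> \<le> (\<Sum>u<m. 3)"
      proof (rule sum_mono)
        fix u assume u: "u \<in> {..<m}"
        \<comment> \<open>For \<open>i = a * m + u \<le> k\<close> the index \<open>k - i\<close>
          lies in block \<open>?K - a\<close>, so each offset contributes at most one convolution of
          \<open>witness_step\<close>, taken at \<open>?K\<close>.\<close>
        let ?K = "(k - u) div m"
        have "f (a * m + u) \<le> (if a \<le> ?K then witness_step a * witness_step (?K - a) else 0)" for a
        proof (cases "a * m + u \<le> k")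
          case True
          then have "a \<le> ?K" using m by (simp add: less_eq_div_iff_mult_less_eq)
          moreover have "(k - (a * m + u)) div m = ?K - a"
          proof -
            have "k - u = (k - (a * m + u)) + a * m" using True by simp
            then have "?K = (k - (a * m + u)) div m + a" using m by (simp only: div_mult_self3) simp
            then show ?thesis by simp
          qed
          ultimately show ?thesis using u True by (simp add: f_def)
        qed (auto simp: f_def witness_step_bounds)
        then have "(\<Sum>a<8. f (a * m + u)) \<le> (\<Sum>a<8. if a \<le> ?K then witness_step a * witness_step (?K - a) else 0)"
          by (intro sum_mono)
        also have "\<dots> = (\<Sum>a\<in>{a. a < 8 \<and> a \<le> ?K}. witness_step a * witness_step (?K - a))"
          by (simp add: sum.If_cases Int_def lessThan_def)
        also have "\<dots> \<le> (\<Sum>a\<le>?K. witness_step a * witness_step (?K - a))"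
          by (rule sum_mono2) (auto simp: witness_step_bounds)
        also have "\<dots> \<le> 3" by (rule witness_step_conv)
        finally show "(\<Sum>a<8. f (a * m + u)) \<le> 3" .
      qed
      also have "h\<^sup>2 * (\<Sum>u<m. 3) = real (8 * m) * (96/121 * \<epsilon>\<^sup>2)"
        by (simp add: h_def power2_eq_square)
      finally show ?thesis by (simp add: mult_left_mono)
    qed
    have "0 \<le> p i \<and> p i \<le> 1" for i
      using h witness_step_bounds[of "i div m"] by (auto simp: p_def intro: mult_le_one)
    moreover have "N \<le> 8 * m" by (simp add: m_def)
    ultimately show "\<exists>n\<ge>N. \<exists>p. (\<forall>i. 0 \<le> p i \<and> p i \<le> 1)
     \<and> real n * \<epsilon> - 1 \<le> (\<Sum>i<n. p i)
     \<and> (\<forall>k. (\<Sum>i | i < n \<and> i \<le> k \<and> k - i < n. p i * p (k - i)) \<le> real n * (96/121 * \<epsilon>\<^sup>2))"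
      using sum conv by (intro exI[of _ "8 * m"] conjI exI[of _ p]) auto
  qed
qed (use \<epsilon> in auto)

text \<open>With \<open>m = k + 2\<close> and \<open>a = i + 1\<close> the summands are
  \<open>1 / sqrt (a * (m - a))\<close>, and the integral of this function over
  \<open>{0..m}\<close> is \<open>pi\<close>. It decreases up to \<open>m / 2\<close> and increases
  afterwards, so a term in the left half is at most the integral over the unit interval before it,
  and one in the right half at most that over the unit interval after it. These intervals do not
  overlap.\<close>

lemma sum_inverse_sqrt_conv_le_pi:
  "(\<Sum>i\<le>k. 1 / (sqrt (real i + 1) * sqrt (real (k - i) + 1))) \<le> pi"
proof -
  define m where "m = real k + 2"
  \<comment> \<open>An antiderivative of \<open>g\<close>, rising from \<open>- pi / 2\<close> to
    \<open>pi / 2\<close>.\<close>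
  define F where "F t = arcsin (2 * t / m - 1)" for t
  define g where "g t = 1 / sqrt (t * (m - t))" for t
  have m: "2 \<le> m" by (simp add: m_def)
  have deriv: "(F has_real_derivative g t) (at t)" if "0 < t" "t < m" for t
  proof -
    have "2 * t / m - 1 < 1" "-1 < 2 * t / m - 1" using that m by (simp_all add: field_simps)
    then have "(F has_real_derivative inverse (sqrt (1 - (2 * t / m - 1)\<^sup>2)) * (2 / m)) (at t)"
      unfolding F_def by (auto intro!: derivative_eq_intros)
    moreover have "1 - (2 * t / m - 1)\<^sup>2 = (2 / m)\<^sup>2 * (t * (m - t))"
      using m by (simp add: field_simps power2_eq_square)
    then have "sqrt (1 - (2 * t / m - 1)\<^sup>2) = 2 / m * sqrt (t * (m - t))"
      using m by (simp only: real_sqrt_mult) simp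
    then have "inverse (sqrt (1 - (2 * t / m - 1)\<^sup>2)) * (2 / m) = g t"
      using m that by (simp add: g_def field_simps)
    ultimately show ?thesis by simp
  qed
  have cont: "continuous_on {0..m} F"
    unfolding F_def by (intro continuous_intros) (use m in \<open>auto simp: field_simps\<close>)
  have mvt: "\<exists>\<xi>>s. \<xi> < t \<and> F t - F s = (t - s) * g \<xi>" if "0 \<le> s" "s < t" "t \<le> m" for s t
  proof -
    have "\<exists>l \<xi>. s < \<xi> \<and> \<xi> < t \<and> (F has_real_derivative l) (at \<xi>) \<and> F t - F s = (t - s) * l"
    proof (rule MVT)
      show "continuous_on {s..t} F" using cont by (rule continuous_on_subset) (use that in auto)
      show "F differentiable (at x)" if "s < x" "x < t" for x
        using deriv[of x] that \<open>0 \<le> s\<close> \<open>t \<le> m\<close> real_differentiable_def by auto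
    qed (use that in auto)
    then obtain l \<xi> where "s < \<xi>" "\<xi> < t" "(F has_real_derivative l) (at \<xi>)" "F t - F s = (t - s) * l"
      by blast
    moreover from this have "l = g \<xi>" using deriv[of \<xi>] that DERIV_unique by auto
    ultimately show ?thesis by blast
  qed
  have mono: "F s \<le> F t" if "0 \<le> s" "s \<le> t" "t \<le> m" for s t
    unfolding F_def by (rule arcsin_le_arcsin) (use that m in \<open>auto simp: field_simps\<close>)
  have step_left: "g a \<le> F a - F (a - 1)" if "1 \<le> a" "2 * a \<le> m" for a
  proof -
    have "\<exists>\<xi>>a - 1. \<xi> < a \<and> F a - F (a - 1) = g \<xi>"
      using mvt[of "a - 1" a] that m by simp
    then obtain \<xi> where \<xi>: "a - 1 < \<xi>" "\<xi> < a" "F a - F (a - 1) = g \<xi>" by blast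
    \<comment> \<open>This product equals \<open>a * (m - a) - \<xi> * (m - \<xi>)\<close>; the
      point farther from the middle has the larger value of \<open>g\<close>.\<close>
    have "0 \<le> (a - \<xi>) * (m - a - \<xi>)" using \<xi> that by simp
    then have "\<xi> * (m - \<xi>) \<le> a * (m - a)" by (simp add: algebra_simps)
    moreover have "0 < \<xi> * (m - \<xi>)" using \<xi> that m by simp
    ultimately show ?thesis unfolding \<xi>(3) g_def by (simp add: frac_le)
  qed
  have step_right: "g a \<le> F (a + 1) - F a" if "a + 1 \<le> m" "m \<le> 2 * a" for a
  proof -
    have "\<exists>\<xi>>a. \<xi> < a + 1 \<and> F (a + 1) - F a = g \<xi>"
      using mvt[of a "a + 1"] that m by simp
    then obtain \<xi> where \<xi>: "a < \<xi>" "\<xi> < a + 1" "F (a + 1) - F a = g \<xi>" by blast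
    have "0 \<le> (\<xi> - a) * (a + \<xi> - m)" using \<xi> that by simp
    then have "\<xi> * (m - \<xi>) \<le> a * (m - a)" by (simp add: algebra_simps)
    moreover have "0 < \<xi> * (m - \<xi>)" using \<xi> that m by simp
    ultimately show ?thesis unfolding \<xi>(3) g_def by (simp add: frac_le)
  qed
  \<comment> \<open>\<open>T\<close> follows \<open>F\<close> in the left half and runs one unit
    ahead past the middle, so its increments dominate both kinds of step and the sum
    telescopes.\<close>
  define T where "T a = (if 2 * real a \<le> m then F a else F (real a + 1))" for a :: nat
  have "(\<Sum>i\<le>k. 1 / (sqrt (real i + 1) * sqrt (real (k - i) + 1))) = (\<Sum>i<Suc k. g (real (Suc i)))"
    by (rule sum.cong) (auto simp: g_def m_def of_nat_diff real_sqrt_mult add_ac diff_add_eq)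
  also have "\<dots> \<le> (\<Sum>i<Suc k. T (Suc i) - T i)"
  proof (rule sum_mono)
    fix i assume "i \<in> {..<Suc k}"
    then have i: "real i \<le> real k" by simp
    show "g (real (Suc i)) \<le> T (Suc i) - T i"
      using step_left[of "real (Suc i)"] step_right[of "real (Suc i)"] i mono[of "real i" "real i + 1"]
      by (auto simp: T_def m_def algebra_simps)
  qed
  also have "\<dots> = T (Suc k) - T 0" by (rule sum_lessThan_telescope)
  also have "\<dots> \<le> F m - F 0"
    using mono[of "real (Suc k)" m] m by (auto simp: T_def m_def add_ac)
  also have "\<dots> = pi" using m by (simp add: F_def)
  finally show ?thesis .
qed

text \<open>A Riemann sum: the profile \<open>min 1 (\<beta> / sqrt x)\<close> decreases, so its
  value at \<open>(i + 1) / n\<close> dominates its mean from there to \<open>(i + 2) / n\<close>.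
  Its integral up to 1 is \<open>2 * \<beta> - \<beta>\<^sup>2\<close>, and the omitted initial
  interval costs at most \<open>1 / n\<close>.\<close>

lemma sum_truncated_inverse_sqrt_ge:
  fixes \<beta> :: real
  assumes \<beta>: "0 < \<beta>" "\<beta> \<le> 1" and n: "0 < n"
  shows "n * (2 * \<beta> - \<beta>\<^sup>2) - 1 \<le> (\<Sum>i<n. min 1 (\<beta> * sqrt n / sqrt (real i + 1)))"
proof -
  \<comment> \<open>The antiderivative of the profile that vanishes at 0; its two pieces meet at
    \<open>\<beta>\<^sup>2\<close>.\<close>
  define \<Phi> where "\<Phi> x = (if x \<le> \<beta>\<^sup>2 then x else 2 * \<beta> * sqrt x - \<beta>\<^sup>2)" for x
  have \<Phi>_le: "\<Phi> x \<le> x" if "0 \<le> x" for x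
    using that zero_le_power2[of "sqrt x - \<beta>"] by (auto simp: \<Phi>_def power2_diff algebra_simps)
  have \<Phi>_diff: "\<Phi> b - \<Phi> a \<le> min 1 (\<beta> / sqrt a) * (b - a)" if ab: "0 < a" "a \<le> b" for a b
  proof (cases "a \<le> \<beta>\<^sup>2")
    case True
    then have "sqrt a \<le> \<beta>" using \<beta> by (simp add: real_le_lsqrt)
    then have "min 1 (\<beta> / sqrt a) = 1" using ab by simp
    then show ?thesis using \<Phi>_le[of b] ab True by (simp add: \<Phi>_def)
  next
    case False
    then have *: "\<beta> < sqrt a" by (intro real_less_rsqrt) simp
    \<comment> \<open>Concavity of the square root in elementary form: its graph lies below the
      tangent at \<open>a\<close>.\<close>
    have "0 \<le> (sqrt b - sqrt a)\<^sup>2" by simp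
    then have "2 * (sqrt a * sqrt b) \<le> a + b" using ab by (simp add: power2_diff mult.commute)
    moreover have "2 * sqrt a * (sqrt b - sqrt a) = 2 * (sqrt a * sqrt b) - 2 * a"
      using ab by (simp add: right_diff_distrib)
    ultimately have "2 * sqrt a * (sqrt b - sqrt a) \<le> b - a" by linarith
    then have "\<beta> / sqrt a * (2 * sqrt a * (sqrt b - sqrt a)) \<le> \<beta> / sqrt a * (b - a)"
      by (rule mult_left_mono) (use \<beta> ab in auto)
    moreover have "\<beta> / sqrt a * (2 * sqrt a * (sqrt b - sqrt a)) = 2 * \<beta> * (sqrt b - sqrt a)"
      using ab by simp
    moreover have "min 1 (\<beta> / sqrt a) = \<beta> / sqrt a" using * ab by simp
    ultimately show ?thesis using False ab by (simp add: \<Phi>_def algebra_simps)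
  qed
  define x where "x i = (real i + 1) / n" for i
  have "2 * \<beta> - \<beta>\<^sup>2 \<le> \<Phi> (x n)"
  proof -
    have "1 < x n" using n by (simp add: x_def)
    moreover have "\<beta>\<^sup>2 \<le> 1" using \<beta> by (simp add: power_le_one)
    ultimately show ?thesis using \<beta> by (auto simp: \<Phi>_def)
  qed
  moreover have "\<Phi> (x 0) \<le> 1 / n" using \<Phi>_le[of "x 0"] n by (simp add: x_def)
  ultimately have "2 * \<beta> - \<beta>\<^sup>2 - 1 / n \<le> \<Phi> (x n) - \<Phi> (x 0)" by simp
  also have "\<dots> = (\<Sum>i<n. \<Phi> (x (Suc i)) - \<Phi> (x i))" by (rule sum_lessThan_telescope[symmetric])
  also have "\<dots> \<le> (\<Sum>i<n. min 1 (\<beta> * sqrt n / sqrt (real i + 1)) * (1 / n))"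
  proof (rule sum_mono)
    fix i
    have "x (Suc i) - x i = 1 / n" by (simp add: x_def diff_divide_distrib[symmetric])
    moreover have "\<beta> / sqrt (x i) = \<beta> * sqrt n / sqrt (real i + 1)" by (simp add: x_def real_sqrt_divide)
    moreover have "0 < x i" using n by (simp add: x_def)
    moreover have "x i \<le> x (Suc i)" by (simp add: x_def divide_right_mono)
    ultimately show "\<Phi> (x (Suc i)) - \<Phi> (x i) \<le> min 1 (\<beta> * sqrt n / sqrt (real i + 1)) * (1 / n)"
      using \<Phi>_diff[of "x i" "x (Suc i)"] by simp
  qed
  also have "\<dots> = (\<Sum>i<n. min 1 (\<beta> * sqrt n / sqrt (real i + 1))) / n"
    by (simp add: sum_divide_distrib)
  finally have "(2 * \<beta> - \<beta>\<^sup>2 - 1 / n) * n \<le> (\<Sum>i<n. min 1 (\<beta> * sqrt n / sqrt (real i + 1)))"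
    using n by (simp only: pos_le_divide_eq of_nat_0_less_iff)
  then show ?thesis using n by (simp add: right_diff_distrib mult.commute[of _ "real n"])
qed

lemma Delta_le_pi:
  assumes \<epsilon>: "0 < \<epsilon>" "\<epsilon> \<le> 1"
  shows "Delta \<epsilon> \<le> pi * \<epsilon>\<^sup>2 / (1 + sqrt (1 - \<epsilon>))\<^sup>2"
proof -
  \<comment> \<open>Chosen so that the mean
    \<open>2 * \<beta> - \<beta>\<^sup>2 = 1 - (1 - \<beta>)\<^sup>2\<close> is
    \<open>\<epsilon>\<close>; rationalizing gives
    \<open>\<beta> = \<epsilon> / (1 + sqrt (1 - \<epsilon>))\<close>, the form of the
    claim.\<close>
  define \<beta> where "\<beta> = 1 - sqrt (1 - \<epsilon>)"
  have \<beta>: "0 < \<beta>" "\<beta> \<le> 1" using \<epsilon> by (auto simp: \<beta>_def)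
  have s: "(sqrt (1 - \<epsilon>))\<^sup>2 = 1 - \<epsilon>" using \<epsilon> by simp
  have \<beta>_mult: "\<beta> * (1 + sqrt (1 - \<epsilon>)) = \<epsilon>"
    using s by (simp add: \<beta>_def algebra_simps power2_eq_square)
  have \<epsilon>_eq: "2 * \<beta> - \<beta>\<^sup>2 = \<epsilon>" using s by (simp add: \<beta>_def power2_diff)
  have "Delta \<epsilon> \<le> pi * \<beta>\<^sup>2"
  proof (rule Delta_le_of_profiles)
    have "\<forall>\<^sub>F n in sequentially. \<exists>p. (\<forall>i. 0 \<le> p i \<and> p i \<le> 1)
     \<and> n * \<epsilon> - 1 \<le> (\<Sum>i<n. p i)
     \<and> (\<forall>k. (\<Sum>i | i < n \<and> i \<le> k \<and> k - i < n. p i * p (k - i)) \<le> n * (pi * \<beta>\<^sup>2))"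
    proof (rule eventually_mono[OF eventually_gt_at_top[of 0]])
      fix n :: nat assume n: "0 < n"
      define p where "p i = min 1 (\<beta> * sqrt n / sqrt (real i + 1))" for i :: nat
      have p: "0 \<le> p i \<and> p i \<le> 1" for i using \<beta> by (simp add: p_def)
      have "(\<Sum>i | i < n \<and> i \<le> k \<and> k - i < n. p i * p (k - i)) \<le> n * (pi * \<beta>\<^sup>2)" for k
      proof -
        have "(\<Sum>i | i < n \<and> i \<le> k \<and> k - i < n. p i * p (k - i)) \<le> (\<Sum>i\<le>k. p i * p (k - i))"
          by (rule sum_mono2) (use p in auto)
        also have "\<dots> \<le> (\<Sum>i\<le>k. n * \<beta>\<^sup>2 * (1 / (sqrt (real i + 1) * sqrt (real (k - i) + 1))))"
        proof (rule sum_mono)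
          fix i
          have "p i * p (k - i) \<le> (\<beta> * sqrt n / sqrt (real i + 1)) * (\<beta> * sqrt n / sqrt (real (k - i) + 1))"
            using p[of "k - i"] \<beta> by (intro mult_mono) (auto simp: p_def)
          also have "\<dots> = n * \<beta>\<^sup>2 * (1 / (sqrt (real i + 1) * sqrt (real (k - i) + 1)))"
            by (simp add: power2_eq_square)
          finally show "p i * p (k - i) \<le> n * \<beta>\<^sup>2 * (1 / (sqrt (real i + 1) * sqrt (real (k - i) + 1)))" .
        qed
        also have "\<dots> = n * \<beta>\<^sup>2 * (\<Sum>i\<le>k. 1 / (sqrt (real i + 1) * sqrt (real (k - i) + 1)))"
          by (rule sum_distrib_left[symmetric])
        also have "\<dots> \<le> n * \<beta>\<^sup>2 * pi"
          by (intro mult_left_mono sum_inverse_sqrt_conv_le_pi) auto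
        finally show ?thesis by (simp add: mult_ac)
      qed
      moreover have "n * \<epsilon> - 1 \<le> (\<Sum>i<n. p i)"
        using sum_truncated_inverse_sqrt_ge[OF \<beta> n] unfolding \<epsilon>_eq p_def .
      ultimately show "\<exists>p. (\<forall>i. 0 \<le> p i \<and> p i \<le> 1)
       \<and> n * \<epsilon> - 1 \<le> (\<Sum>i<n. p i)
       \<and> (\<forall>k. (\<Sum>i | i < n \<and> i \<le> k \<and> k - i < n. p i * p (k - i)) \<le> n * (pi * \<beta>\<^sup>2))"
        using p by blast
    qed
    then show "\<exists>\<^sub>F n in sequentially. \<exists>p. (\<forall>i. 0 \<le> p i \<and> p i \<le> 1)
     \<and> n * \<epsilon> - 1 \<le> (\<Sum>i<n. p i)
     \<and> (\<forall>k. (\<Sum>i | i < n \<and> i \<le> k \<and> k - i < n. p i * p (k - i)) \<le> n * (pi * \<beta>\<^sup>2))"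
      by (rule eventually_frequently[OF sequentially_bot])
  qed (use \<epsilon> in auto)
  also have "pi * \<beta>\<^sup>2 = pi * \<epsilon>\<^sup>2 / (1 + sqrt (1 - \<epsilon>))\<^sup>2"
  proof -
    have "0 < 1 + sqrt (1 - \<epsilon>)" using \<epsilon> by (intro add_pos_nonneg) auto
    moreover have "\<epsilon>\<^sup>2 = \<beta>\<^sup>2 * (1 + sqrt (1 - \<epsilon>))\<^sup>2"
      by (simp only: \<beta>_mult flip: power_mult_distrib)
    ultimately show ?thesis by simp
  qed
  finally show ?thesis .
qed

subsection \<open>Lower bounds\<close>

definition acorr :: "(real \<Rightarrow> ennreal) \<Rightarrow> real \<Rightarrow> ennreal" where
  "acorr f x = (\<integral>\<^sup>+y. f y * f (y + x) \<partial>lborel)"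

definition aconv :: "(real \<Rightarrow> ennreal) \<Rightarrow> real \<Rightarrow> ennreal" where
  "aconv f x = (\<integral>\<^sup>+y. f y * f (x - y) \<partial>lborel)"

lemma acorr_measurable [measurable]:
  assumes [measurable]: "f \<in> borel_measurable borel"
  shows "acorr f \<in> borel_measurable borel"
  unfolding acorr_def by measurable

lemma aconv_measurable [measurable]:
  assumes [measurable]: "f \<in> borel_measurable borel"
  shows "aconv f \<in> borel_measurable borel"
  unfolding aconv_def by measurable

lemma nn_integral_shift:
  assumes [measurable]: "f \<in> borel_measurable borel"
  shows "(\<integral>\<^sup>+x. f (x + a :: real) \<partial>lborel) = (\<integral>\<^sup>+x. f x \<partial>lborel)"
  using nn_integral_real_affine[OF assms, of 1 a] by (simp add: add.commute)

lemma nn_integral_reflect: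
  assumes [measurable]: "f \<in> borel_measurable borel"
  shows "(\<integral>\<^sup>+x. f (a - x :: real) \<partial>lborel) = (\<integral>\<^sup>+x. f x \<partial>lborel)"
  using nn_integral_real_affine[OF assms, of "-1" a] by simp

lemma acorr_even:
  assumes [measurable]: "f \<in> borel_measurable borel"
  shows "acorr f (- x) = acorr f x"
  using nn_integral_shift[of "\<lambda>y. f y * f (y - x)" x] by (simp add: acorr_def mult.commute)

lemma acorr_reflect:
  assumes [measurable]: "f \<in> borel_measurable borel"
  shows "acorr (\<lambda>y. f (a - y)) x = acorr f x"
proof -
  have "acorr (\<lambda>y. f (a - y)) x = (\<integral>\<^sup>+y. f (a - y) * f ((a - y) - x) \<partial>lborel)"
    by (simp add: acorr_def diff_diff_add)
  also have "\<dots> = acorr f (- x)"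
    using nn_integral_reflect[of "\<lambda>y. f y * f (y - x)" a] by (simp add: acorr_def)
  finally show ?thesis by (simp add: acorr_even)
qed

lemma nn_integral_acorr:
  assumes [measurable]: "f \<in> borel_measurable borel"
  shows "(\<integral>\<^sup>+x. acorr f x \<partial>lborel) = (\<integral>\<^sup>+x. f x \<partial>lborel)\<^sup>2"
proof -
  have "(\<integral>\<^sup>+x. acorr f x \<partial>lborel) = (\<integral>\<^sup>+y. (\<integral>\<^sup>+x. f y * f (y + x) \<partial>lborel) \<partial>lborel)"
    unfolding acorr_def by (rule lborel_pair.Fubini') simp
  also have "\<dots> = (\<integral>\<^sup>+y. f y * (\<integral>\<^sup>+x. f x \<partial>lborel) \<partial>lborel)"
    using nn_integral_shift[of f y for y] by (simp add: nn_integral_cmult add.commute)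
  finally show ?thesis by (simp add: nn_integral_multc power2_eq_square)
qed

lemma nn_integral_aconv:
  assumes [measurable]: "f \<in> borel_measurable borel"
  shows "(\<integral>\<^sup>+x. aconv f x \<partial>lborel) = (\<integral>\<^sup>+x. f x \<partial>lborel)\<^sup>2"
proof -
  have "(\<integral>\<^sup>+x. aconv f x \<partial>lborel) = (\<integral>\<^sup>+y. (\<integral>\<^sup>+x. f y * f (x - y) \<partial>lborel) \<partial>lborel)"
    unfolding aconv_def by (rule lborel_pair.Fubini') simp
  also have "\<dots> = (\<integral>\<^sup>+y. f y * (\<integral>\<^sup>+x. f x \<partial>lborel) \<partial>lborel)"
    using nn_integral_shift[of f "- y" for y] by (simp add: nn_integral_cmult)
  finally show ?thesis by (simp add: nn_integral_multc power2_eq_square)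
qed

text \<open>Expand the square into a double integral over \<open>y\<close> and \<open>z\<close> and
  integrate over \<open>x\<close> first: the two kernels give \<open>acorr k (z - y)\<close>, and
  the shift \<open>z = y + x\<close> then produces \<open>acorr g x\<close>. Values in
  \<open>ennreal\<close> make every exchange an instance of Tonelli's theorem.\<close>

lemma nn_integral_square_smoothing:
  assumes [measurable]: "g \<in> borel_measurable borel" "k \<in> borel_measurable borel"
  shows "(\<integral>\<^sup>+x. (\<integral>\<^sup>+y. g y * k (y - x) \<partial>lborel)\<^sup>2 \<partial>lborel) = (\<integral>\<^sup>+x. acorr g x * acorr k x \<partial>lborel)"
proof -
  have "(\<integral>\<^sup>+x. (\<integral>\<^sup>+y. g y * k (y - x) \<partial>lborel)\<^sup>2 \<partial>lborel)
      = (\<integral>\<^sup>+x. (\<integral>\<^sup>+y. (\<integral>\<^sup>+z. g y * g z * (k (y - x) * k (z - x)) \<partial>lborel) \<partial>lborel) \<partial>lborel)"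
    by (simp add: power2_eq_square nn_integral_cmult[symmetric] nn_integral_multc[symmetric] mult_ac)
  also have "\<dots> = (\<integral>\<^sup>+y. (\<integral>\<^sup>+x. (\<integral>\<^sup>+z. g y * g z * (k (y - x) * k (z - x)) \<partial>lborel) \<partial>lborel) \<partial>lborel)"
    by (rule lborel_pair.Fubini') simp
  also have "\<dots> = (\<integral>\<^sup>+y. (\<integral>\<^sup>+z. (\<integral>\<^sup>+x. g y * g z * (k (y - x) * k (z - x)) \<partial>lborel) \<partial>lborel) \<partial>lborel)"
    by (intro nn_integral_cong lborel_pair.Fubini') simp
  also have "\<dots> = (\<integral>\<^sup>+y. (\<integral>\<^sup>+z. g y * g z * acorr k (z - y) \<partial>lborel) \<partial>lborel)"
  proof (intro nn_integral_cong)
    fix y z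
    have "(\<integral>\<^sup>+x. k (y - x) * k (z - x) \<partial>lborel) = (\<integral>\<^sup>+x. (\<lambda>w. k w * k (w + (z - y))) (y - x) \<partial>lborel)"
      by simp
    also have "\<dots> = acorr k (z - y)"
      unfolding acorr_def by (rule nn_integral_reflect) simp
    finally show "(\<integral>\<^sup>+x. g y * g z * (k (y - x) * k (z - x)) \<partial>lborel) = g y * g z * acorr k (z - y)"
      by (simp add: nn_integral_cmult)
  qed
  also have "\<dots> = (\<integral>\<^sup>+y. (\<integral>\<^sup>+x. g y * g (y + x) * acorr k x \<partial>lborel) \<partial>lborel)"
  proof (rule nn_integral_cong)
    fix y
    show "(\<integral>\<^sup>+z. g y * g z * acorr k (z - y) \<partial>lborel) = (\<integral>\<^sup>+x. g y * g (y + x) * acorr k x \<partial>lborel)"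
      using nn_integral_shift[of "\<lambda>z. g y * g z * acorr k (z - y)" y] by (simp add: add.commute)
  qed
  also have "\<dots> = (\<integral>\<^sup>+x. (\<integral>\<^sup>+y. g y * g (y + x) * acorr k x \<partial>lborel) \<partial>lborel)"
    by (rule lborel_pair.Fubini') simp
  finally show ?thesis by (simp add: nn_integral_multc acorr_def)
qed

text \<open>Convolving \<open>f\<close> with itself is smoothing \<open>f\<close> by its mirror
  image, and mirror images have equal autocorrelations.\<close>

lemma nn_integral_aconv_square:
  assumes [measurable]: "f \<in> borel_measurable borel"
  shows "(\<integral>\<^sup>+x. (aconv f x)\<^sup>2 \<partial>lborel) = (\<integral>\<^sup>+x. (acorr f x)\<^sup>2 \<partial>lborel)"
  using nn_integral_square_smoothing[of f "\<lambda>y. f (0 - y)"] acorr_reflect[OF assms, of 0]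
  by (simp add: aconv_def power2_eq_square)

section \<open>The triangular kernel and its pairing with the autocorrelation\<close>

definition window :: "real \<Rightarrow> ennreal" where "window = indicator {0..1/4}"

lemma window_measurable [measurable]: "window \<in> borel_measurable borel"
  by (simp add: window_def)

lemma nn_integral_window: "(\<integral>\<^sup>+x. window x \<partial>lborel) = ennreal (1/4)"
  by (simp add: window_def)

text \<open>Two shifted windows overlap in an interval of this length. The triangle has mass 1/16,
  so sixteen times it is a probability density, the kernel of the argument.\<close>

lemma acorr_window: "acorr window x = ennreal (max 0 (1/4 - \<bar>x\<bar>))"
proof -
  have "acorr window x = (\<integral>\<^sup>+y. indicator {max 0 (-x)..min (1/4) (1/4 - x)} y \<partial>lborel)"
    unfolding acorr_def window_def by (intro nn_integral_cong) (auto split: split_indicator)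
  also have "\<dots> = ennreal (max 0 (1/4 - \<bar>x\<bar>))"
    by (auto simp: emeasure_lborel_Icc_eq max_def min_def abs_if)
  finally show ?thesis .
qed

text \<open>Each half of the squared triangle contributes 1/192. The two halves share the point 0,
  so the pointwise comparison is an inequality.\<close>

lemma nn_integral_acorr_window_square: "(\<integral>\<^sup>+x. (acorr window x)\<^sup>2 \<partial>lborel) \<le> ennreal (1/96)"
proof -
  let ?l = "\<lambda>x::real. (1/4 + x)\<^sup>2"
  let ?r = "\<lambda>x::real. (1/4 - x)\<^sup>2"
  have l: "(\<integral>\<^sup>+x. ennreal (?l x) * indicator {-1/4..0} x \<partial>lborel) = ennreal ((1/4 + 0)^3 / 3 - (1/4 + (-1/4))^3 / 3)"
    by (rule nn_integral_FTC_Icc[where F = "\<lambda>x. (1/4 + x)^3 / 3"]) (auto intro!: derivative_eq_intros)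
  have r: "(\<integral>\<^sup>+x. ennreal (?r x) * indicator {0..1/4} x \<partial>lborel) = ennreal (- ((1/4 - 1/4)^3 / 3) - (- ((1/4 - 0)^3 / 3)))"
    by (rule nn_integral_FTC_Icc[where F = "\<lambda>x. - ((1/4 - x)^3 / 3)"]) (auto intro!: derivative_eq_intros)
  have "(\<integral>\<^sup>+x. (acorr window x)\<^sup>2 \<partial>lborel)
      \<le> (\<integral>\<^sup>+x. ennreal (?l x) * indicator {-1/4..0} x + ennreal (?r x) * indicator {0..1/4} x \<partial>lborel)"
  proof (rule nn_integral_mono)
    fix x :: real
    show "(acorr window x)\<^sup>2 \<le> ennreal (?l x) * indicator {-1/4..0} x + ennreal (?r x) * indicator {0..1/4} x"
    proof -
      have eq: "(acorr window x)\<^sup>2 = ennreal ((max 0 (1/4 - \<bar>x\<bar>))\<^sup>2)"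
        unfolding acorr_window by (rule ennreal_power) simp
      consider "\<bar>x\<bar> > 1/4" | "x \<in> {0..1/4}" | "x \<in> {-1/4..0}"
        unfolding atLeastAtMost_iff by linarith
      then show ?thesis
      proof cases
        case 2
        then have "(acorr window x)\<^sup>2 = ennreal (?r x) * indicator {0..1/4} x" by (simp add: eq)
        then show ?thesis by simp
      next
        case 3
        then have "(acorr window x)\<^sup>2 = ennreal (?l x) * indicator {-1/4..0} x" by (simp add: eq)
        then show ?thesis by simp
      qed (simp add: eq)
    qed
  qed
  also have "\<dots> = ennreal (1/192) + ennreal (1/192)"
  proof -
    have "(\<integral>\<^sup>+x. ennreal (?l x) * indicator {-1/4..0} x \<partial>lborel) = ennreal (1/192)"
      unfolding l by (simp add: power3_eq_cube)
    moreover have "(\<integral>\<^sup>+x. ennreal (?r x) * indicator {0..1/4} x \<partial>lborel) = ennreal (1/192)"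
      unfolding r by (simp add: power3_eq_cube)
    ultimately show ?thesis by (subst nn_integral_add) auto
  qed
  also have "\<dots> = ennreal (1/96)" by (simp flip: ennreal_plus)
  finally show ?thesis .
qed

text \<open>Smoothing f and its mirror image about 1/2 by the window and applying the Cauchy--Schwarz
  inequality on an interval of length 5/4.\<close>
lemma acorr_window_lower:
  fixes f :: "real \<Rightarrow> ennreal"
  assumes [measurable]: "f \<in> borel_measurable borel"
    and supp: "\<And>x. x \<notin> {0..1} \<Longrightarrow> f x = 0"
    and e: "(\<integral>\<^sup>+x. f x \<partial>lborel) = ennreal e" "0 \<le> e"
    and d: "\<And>x. aconv f x \<le> ennreal d" "0 \<le> d"
  shows "ennreal (e\<^sup>2 / 5) \<le> 2 * (\<integral>\<^sup>+x. acorr f x * acorr window x \<partial>lborel) + ennreal (d / 8)"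
proof -
  \<comment> \<open>With the mirror image added, the autocorrelation acquires cross terms that are
    autoconvolution values, hence at most \<open>d\<close>.\<close>
  define g where "g y = f y + f (1 - y)" for y
  have [measurable]: "g \<in> borel_measurable borel" unfolding g_def by measurable
  define W where "W x = (\<integral>\<^sup>+y. g y * window (y - x) \<partial>lborel)" for x
  have [measurable]: "W \<in> borel_measurable borel" unfolding W_def by measurable
  have int_g: "(\<integral>\<^sup>+x. g x \<partial>lborel) = ennreal (2 * e)"
    using e by (simp add: g_def nn_integral_add nn_integral_reflect[of f 1] flip: ennreal_plus)
  have W_fin: "W x \<noteq> \<infinity>" for x
  proof -
    have "W x \<le> (\<integral>\<^sup>+x. g x \<partial>lborel)"
      unfolding W_def by (intro nn_integral_mono) (auto simp: window_def split: split_indicator)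
    then show ?thesis by (auto simp: int_g top_unique)
  qed
  have W_supp: "W x = 0" if "x \<notin> {-1/4..1}" for x
  proof -
    have "g y * window (y - x) = 0" for y
      using that supp[of y] supp[of "1 - y"] by (auto simp: g_def window_def split: split_indicator)
    then show ?thesis by (simp only: W_def) simp
  qed
  have int_W: "(\<integral>\<^sup>+x. W x \<partial>lborel) = ennreal (e / 2)"
  proof -
    have "(\<integral>\<^sup>+x. W x \<partial>lborel) = (\<integral>\<^sup>+y. (\<integral>\<^sup>+x. g y * window (y - x) \<partial>lborel) \<partial>lborel)"
      unfolding W_def by (rule lborel_pair.Fubini') simp
    also have "\<dots> = (\<integral>\<^sup>+y. g y * ennreal (1/4) \<partial>lborel)"
      by (simp add: nn_integral_cmult nn_integral_reflect nn_integral_window)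
    also have "\<dots> = ennreal (2 * e) * ennreal (1/4)" by (simp add: nn_integral_multc int_g)
    also have "\<dots> = ennreal (e / 2)" using e by (simp flip: ennreal_mult)
    finally show ?thesis .
  qed
  have int_W2: "(\<integral>\<^sup>+x. (W x)\<^sup>2 \<partial>lborel) = (\<integral>\<^sup>+x. acorr g x * acorr window x \<partial>lborel)"
    unfolding W_def by (rule nn_integral_square_smoothing) auto
  have acorr_g: "acorr g x \<le> 2 * acorr f x + ennreal (2 * d)" for x
  proof -
    have "acorr g x = (\<integral>\<^sup>+y. f y * f (y + x) + f y * f ((1 - x) - y) + f (1 - y) * f (y + x) + f (1 - y) * f (1 - (y + x)) \<partial>lborel)"
      unfolding acorr_def g_def by (intro nn_integral_cong) (simp add: algebra_simps)
    also have "\<dots> = acorr f x + aconv f (1 - x) + (\<integral>\<^sup>+y. f (1 - y) * f (y + x) \<partial>lborel) + acorr (\<lambda>y. f (1 - y)) x"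
      by (simp add: nn_integral_add acorr_def aconv_def)
    also have "(\<integral>\<^sup>+y. f (1 - y) * f (y + x) \<partial>lborel) = aconv f (1 + x)"
      using nn_integral_reflect[of "\<lambda>y. f y * f ((1 + x) - y)" 1] by (simp add: aconv_def add.commute)
    also have "acorr (\<lambda>y. f (1 - y)) x = acorr f x" by (rule acorr_reflect) fact
    also have "acorr f x + aconv f (1 - x) + aconv f (1 + x) + acorr f x
        \<le> acorr f x + ennreal d + ennreal d + acorr f x"
      by (intro add_mono order.refl d)
    also have "\<dots> = 2 * acorr f x + ennreal (2 * d)"
    proof -
      have "ennreal (2 * d) = ennreal d + ennreal d" using d by (simp flip: ennreal_plus)
      then show ?thesis by (simp only: mult_2 add_ac)
    qed
    finally show ?thesis .
  qed
  \<comment> \<open>Cauchy-Schwarz in pointwise form,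
    \<open>2 * t * w \<le> w\<^sup>2 + t\<^sup>2\<close> with \<open>t = 2 * e / 5\<close>: this is
    the mean of \<open>W\<close>, of integral \<open>e / 2\<close>, over an interval of length
    5/4.\<close>
  have pw: "ennreal (4 * e / 5) * W x \<le> (W x)\<^sup>2 + ennreal (4 * e\<^sup>2 / 25) * indicator {-1/4..1} x" for x
  proof (cases "x \<in> {-1/4..1}")
    case True
    obtain w where w: "W x = ennreal w" "0 \<le> w" using W_fin[of x] by (cases "W x") auto
    have "0 \<le> (w - 2 * e / 5)\<^sup>2" by simp
    then have "4 * e / 5 * w \<le> w\<^sup>2 + 4 * e\<^sup>2 / 25" by (simp add: power2_eq_square algebra_simps)
    then have "ennreal (4 * e / 5 * w) \<le> ennreal (w\<^sup>2 + 4 * e\<^sup>2 / 25)" by (rule ennreal_leI)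
    moreover have "ennreal (4 * e / 5) * W x = ennreal (4 * e / 5 * w)"
      using w e by (simp flip: ennreal_mult)
    moreover have "(W x)\<^sup>2 + ennreal (4 * e\<^sup>2 / 25) * indicator {-1/4..1} x = ennreal (w\<^sup>2 + 4 * e\<^sup>2 / 25)"
      using w True by (simp add: ennreal_power ennreal_plus)
    ultimately show ?thesis by simp
  qed (simp add: W_supp)
  have "ennreal (2 * e\<^sup>2 / 5) = (\<integral>\<^sup>+x. ennreal (4 * e / 5) * W x \<partial>lborel)"
    using e by (simp add: nn_integral_cmult int_W power2_eq_square flip: ennreal_mult)
  also have "\<dots> \<le> (\<integral>\<^sup>+x. (W x)\<^sup>2 + ennreal (4 * e\<^sup>2 / 25) * indicator {-1/4..1} x \<partial>lborel)"
    by (intro nn_integral_mono pw)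
  also have "\<dots> = (\<integral>\<^sup>+x. acorr g x * acorr window x \<partial>lborel) + ennreal (e\<^sup>2 / 5)"
    by (simp add: nn_integral_add nn_integral_cmult int_W2 flip: ennreal_mult)
  also have "(\<integral>\<^sup>+x. acorr g x * acorr window x \<partial>lborel)
      \<le> (\<integral>\<^sup>+x. 2 * (acorr f x * acorr window x) + ennreal (2 * d) * acorr window x \<partial>lborel)"
    by (intro nn_integral_mono order.trans[OF mult_right_mono[OF acorr_g]]) (auto simp: algebra_simps)
  also have "\<dots> = 2 * (\<integral>\<^sup>+x. acorr f x * acorr window x \<partial>lborel) + ennreal (d / 8)"
    using d by (simp add: nn_integral_add nn_integral_cmult nn_integral_acorr nn_integral_window ennreal_power
        power2_eq_square flip: ennreal_mult)
  finally have le: "ennreal (2 * e\<^sup>2 / 5) \<le> 2 * (\<integral>\<^sup>+x. acorr f x * acorr window x \<partial>lborel) + ennreal (d / 8) + ennreal (e\<^sup>2 / 5)"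
    by (simp add: add_right_mono)
  have "ennreal (2 * e\<^sup>2 / 5) = ennreal (e\<^sup>2 / 5) + ennreal (e\<^sup>2 / 5)" by (simp flip: ennreal_plus)
  \<comment> \<open>Cancellation in \<open>ennreal\<close> asks for a finite term, here
    \<open>e\<^sup>2 / 5\<close>.\<close>
  moreover have "c \<le> X" if "c + c \<le> X + c" "c \<noteq> \<infinity>" for c X :: ennreal
    using that unfolding add.commute[of X] ennreal_add_left_cancel_le by blast
  ultimately show ?thesis using le by simp
qed

text \<open>Subtract from \<open>acorr f\<close> and from sixteen times the triangle their means
  over \<open>{-1..1}\<close>. A weighted inequality between products and squares bounds the
  integral of the product of these centred functions by the integrals of their squares. Negative
  terms are moved to the other side, as \<open>ennreal\<close> has only truncated
  subtraction.\<close>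

lemma acorr_window_upper:
  fixes f :: "real \<Rightarrow> ennreal"
  assumes [measurable]: "f \<in> borel_measurable borel"
    and supp: "\<And>x. x \<notin> {0..1} \<Longrightarrow> f x = 0" and f1: "\<And>x. f x \<le> 1"
    and e: "(\<integral>\<^sup>+x. f x \<partial>lborel) = ennreal e" "0 \<le> e"
    and d: "\<And>x. aconv f x \<le> ennreal d" "0 \<le> d"
  shows "ennreal (16 * e\<^sup>2) * (\<integral>\<^sup>+x. acorr f x * acorr window x \<partial>lborel) + ennreal (7/4 * e^4)
      \<le> ennreal (295/216 * e^4 + 9/4 * d * e\<^sup>2)"
proof -
  have fin: "acorr f x \<noteq> \<infinity>" for x
  proof -
    have "acorr f x \<le> (\<integral>\<^sup>+x. f x * 1 \<partial>lborel)"
      unfolding acorr_def by (intro nn_integral_mono mult_left_mono f1) auto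
    then show ?thesis by (auto simp: e top_unique)
  qed
  have corr_supp: "acorr f x = 0" if "x \<notin> {-1..1}" for x
  proof -
    have "f y * f (y + x) = 0" for y
    proof (cases "y \<in> {0..1}")
      case True
      then have "y + x \<notin> {0..1}" using that by auto
      then show ?thesis using supp by simp
    qed (simp add: supp)
    then show ?thesis by (simp only: acorr_def) simp
  qed
  \<comment> \<open>The squared autoconvolution has the same integral, and the autoconvolution has
    height at most \<open>d\<close> and mass \<open>e\<^sup>2\<close>.\<close>
  have energy: "(\<integral>\<^sup>+x. (acorr f x)\<^sup>2 \<partial>lborel) \<le> ennreal (d * e\<^sup>2)"
  proof -
    have "(\<integral>\<^sup>+x. (acorr f x)\<^sup>2 \<partial>lborel) = (\<integral>\<^sup>+x. (aconv f x)\<^sup>2 \<partial>lborel)"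
      by (rule nn_integral_aconv_square[symmetric]) fact
    also have "\<dots> \<le> (\<integral>\<^sup>+x. ennreal d * aconv f x \<partial>lborel)"
      unfolding power2_eq_square by (intro nn_integral_mono mult_right_mono d) auto
    also have "\<dots> = ennreal (d * e\<^sup>2)"
      using d e by (simp add: nn_integral_cmult nn_integral_aconv ennreal_power flip: ennreal_mult)
    finally show ?thesis .
  qed
  have pw: "ennreal (16 * e\<^sup>2) * (acorr f x * acorr window x) + ennreal (7/4 * e\<^sup>2) * acorr f x
      \<le> ennreal (56/9 * e^4) * acorr window x + ennreal (49/144 * e^4) * indicator {-1..1} x
        + ennreal (9/4) * (acorr f x)\<^sup>2 + ennreal (256/9 * e^4) * (acorr window x)\<^sup>2" for x
  proof (cases "x \<in> {-1..1}")
    case True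
    obtain q where q: "acorr f x = ennreal q" "0 \<le> q" using fin[of x] by (cases "acorr f x") auto
    define k where "k = max 0 (1/4 - \<bar>x\<bar>)"
    have k: "acorr window x = ennreal k" "0 \<le> k" by (simp_all add: acorr_window k_def)
    \<comment> \<open>The subtracted means are \<open>e\<^sup>2 / 2\<close> and 1/2. The weights 3/2
      and 1/3 give the mixed term the coefficient \<open>e\<^sup>2\<close> and are close to optimal
      when \<open>d\<close> is about \<open>0.61 * e\<^sup>2\<close>.\<close>
    have "0 \<le> (3/2 * (q - e\<^sup>2 / 2) - e\<^sup>2 / 3 * (16 * k - 1/2))\<^sup>2" by simp
    then have "16 * e\<^sup>2 * (q * k) + 7/4 * e\<^sup>2 * q \<le> 56/9 * e^4 * k + 49/144 * e^4 + 9/4 * q\<^sup>2 + 256/9 * e^4 * k\<^sup>2"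
      by (simp add: power2_eq_square power4_eq_xxxx algebra_simps)
    then show ?thesis using True q k e
      by (simp add: ennreal_power flip: ennreal_plus ennreal_mult)
  qed (simp add: corr_supp)
  have "ennreal (16 * e\<^sup>2) * (\<integral>\<^sup>+x. acorr f x * acorr window x \<partial>lborel) + ennreal (7/4 * e^4)
      = (\<integral>\<^sup>+x. ennreal (16 * e\<^sup>2) * (acorr f x * acorr window x) + ennreal (7/4 * e\<^sup>2) * acorr f x \<partial>lborel)"
  proof -
    have "(\<integral>\<^sup>+x. acorr f x \<partial>lborel) = ennreal (e\<^sup>2)"
      using e by (simp add: nn_integral_acorr ennreal_power)
    moreover have "ennreal (7/4 * e\<^sup>2) * ennreal (e\<^sup>2) = ennreal (7/4 * e^4)"
      using e by (simp add: power4_eq_xxxx power2_eq_square flip: ennreal_mult)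
    ultimately show ?thesis by (simp add: nn_integral_add nn_integral_cmult)
  qed
  also have "\<dots> \<le> (\<integral>\<^sup>+x. ennreal (56/9 * e^4) * acorr window x + ennreal (49/144 * e^4) * indicator {-1..1} x
        + ennreal (9/4) * (acorr f x)\<^sup>2 + ennreal (256/9 * e^4) * (acorr window x)\<^sup>2 \<partial>lborel)"
    by (intro nn_integral_mono pw)
  also have "\<dots> = ennreal (56/9 * e^4) * ennreal (1/16) + ennreal (49/144 * e^4) * 2
        + ennreal (9/4) * (\<integral>\<^sup>+x. (acorr f x)\<^sup>2 \<partial>lborel) + ennreal (256/9 * e^4) * (\<integral>\<^sup>+x. (acorr window x)\<^sup>2 \<partial>lborel)"
  proof -
    have "(\<integral>\<^sup>+x. acorr window x \<partial>lborel) = ennreal (1/16)"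
      by (simp add: nn_integral_acorr nn_integral_window ennreal_power power2_eq_square flip: ennreal_mult)
    then show ?thesis by (simp add: nn_integral_add nn_integral_cmult)
  qed
  also have "\<dots> \<le> ennreal (56/9 * e^4) * ennreal (1/16) + ennreal (49/144 * e^4) * ennreal 2
        + ennreal (9/4) * ennreal (d * e\<^sup>2) + ennreal (256/9 * e^4) * ennreal (1/96)"
    by (intro add_mono mult_left_mono energy nn_integral_acorr_window_square) auto
  also have "\<dots> = ennreal (295/216 * e^4 + 9/4 * d * e\<^sup>2)"
  proof -
    have t: "ennreal (56/9 * e^4) * ennreal (1/16) = ennreal (7/18 * e^4)"
      "ennreal (9/4) * ennreal (d * e\<^sup>2) = ennreal (9/4 * d * e\<^sup>2)"
      "ennreal (256/9 * e^4) * ennreal (1/96) = ennreal (8/27 * e^4)"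
      using d by (simp_all flip: ennreal_mult)
    have t': "ennreal (49/144 * e^4) * ennreal 2 = ennreal (49/72 * e^4)"
      by (subst ennreal_mult[symmetric]) auto
    have eq: "295/216 * e^4 + 9/4 * d * e\<^sup>2 = 7/18 * e^4 + 49/72 * e^4 + 9/4 * d * e\<^sup>2 + 8/27 * e^4"
      by simp
    have plus: "ennreal p + ennreal q + ennreal r + ennreal s = ennreal (p + q + r + s)"
      if "0 \<le> p" "0 \<le> q" "0 \<le> r" "0 \<le> s" for p q r s
      using that by simp
    show ?thesis unfolding t t' eq by (rule plus) (use d in auto)
  qed
  finally show ?thesis .
qed

text \<open>With \<open>x\<close> the pairing integral, the two bounds read
  \<open>16 * x \<ge> 8/5 * e\<^sup>2 - d\<close> and
  \<open>16 * x \<le> 9/4 * d - 83/216 * e\<^sup>2\<close>. Eliminating \<open>x\<close> leaves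
  \<open>d\<close> at least slightly more than \<open>0.61 * e\<^sup>2\<close>.\<close>

lemma aconv_sup_lower_bound:
  fixes f :: "real \<Rightarrow> ennreal"
  assumes f: "f \<in> borel_measurable borel" "\<And>x. x \<notin> {0..1} \<Longrightarrow> f x = 0" "\<And>x. f x \<le> 1"
    and e: "(\<integral>\<^sup>+x. f x \<partial>lborel) = ennreal e" "0 \<le> e"
    and d: "\<And>x. aconv f x \<le> ennreal d" "0 \<le> d"
  shows "61/100 * e\<^sup>2 \<le> d"
proof (cases "e = 0")
  case False
  then have e0: "0 < e" using e by simp
  let ?X = "\<integral>\<^sup>+x. acorr f x * acorr window x \<partial>lborel"
  have up: "ennreal (16 * e\<^sup>2) * ?X + ennreal (7/4 * e^4) \<le> ennreal (295/216 * e^4 + 9/4 * d * e\<^sup>2)"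
    by (rule acorr_window_upper) fact+
  have low: "ennreal (e\<^sup>2 / 5) \<le> 2 * ?X + ennreal (d / 8)"
    by (rule acorr_window_lower) fact+
  have "?X \<noteq> \<infinity>"
  proof
    assume "?X = \<infinity>"
    \<comment> \<open>Since \<open>e > 0\<close>, an infinite pairing would make the left side of
      \<open>up\<close> infinite.\<close>
    with up e0 show False by (simp add: ennreal_mult_top top_unique)
  qed
  then obtain x where x: "?X = ennreal x" "0 \<le> x" by (cases ?X) auto
  have "e\<^sup>2 / 5 \<le> 2 * x + d / 8"
  proof -
    have eq: "2 * ennreal x + ennreal (d / 8) = ennreal (2 * x + d / 8)"
      using x(2) d by (simp add: ennreal_mult)
    show ?thesis using low unfolding x(1) eq by (subst (asm) ennreal_le_iff) (use x d in auto)
  qed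
  moreover have "16 * e\<^sup>2 * x + 7/4 * e^4 \<le> 295/216 * e^4 + 9/4 * d * e\<^sup>2"
  proof -
    have eq: "ennreal (16 * e\<^sup>2) * ennreal x + ennreal (7/4 * e^4) = ennreal (16 * e\<^sup>2 * x + 7/4 * e^4)"
      using x(2) by (simp add: ennreal_mult)
    show ?thesis using up unfolding x(1) eq by (subst (asm) ennreal_le_iff) (use d e in auto)
  qed
  then have "e\<^sup>2 * (16 * x + 7/4 * e\<^sup>2) \<le> e\<^sup>2 * (295/216 * e\<^sup>2 + 9/4 * d)"
    by (simp add: power4_eq_xxxx power2_eq_square algebra_simps)
  then have "16 * x + 7/4 * e\<^sup>2 \<le> 295/216 * e\<^sup>2 + 9/4 * d"
    using e0 by simp
  ultimately show ?thesis using zero_le_power2[of e] by linarith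
qed (use d in simp)

text \<open>The main part is a Borel subset of \<open>A\<close> of the same measure, so the
  identities over \<open>lborel\<close> apply to it, and its overlaps lie in those of
  \<open>A\<close>.\<close>

lemma D_lower_bound:
  assumes A: "A \<in> sets lebesgue" "A \<subseteq> {0..<1}"
  shows "61/100 * (measure lebesgue A)\<^sup>2 \<le> D A"
proof (rule aconv_sup_lower_bound)
  let ?B = "main_part lborel A"
  have B: "?B \<in> sets borel" "?B \<subseteq> A"
    using main_part_sets[OF A(1)] main_part_null_part_Un[OF A(1)] by auto
  show "(indicator ?B :: real \<Rightarrow> ennreal) \<in> borel_measurable borel" using B by simp
  show "indicator ?B x = (0::ennreal)" if "x \<notin> {0..1}" for x
    using that B A by (auto split: split_indicator)
  show "indicator ?B x \<le> (1::ennreal)" for x by (simp add: indicator_def)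
  have "(\<integral>\<^sup>+x. indicator ?B x \<partial>lborel) = emeasure lebesgue A"
    using A B by (simp add: emeasure_completion)
  also have "\<dots> = ennreal (measure lebesgue A)"
    by (rule emeasure_eq_measure2[OF lmeasurable_subset_unit[OF A]])
  finally show "(\<integral>\<^sup>+x. indicator ?B x \<partial>lborel) = ennreal (measure lebesgue A)" .
  show "aconv (indicator ?B) c \<le> ennreal (D A)" for c
  proof -
    have [measurable]: "?B \<in> sets borel" by (rule B)
    have sB: "self_overlap ?B c \<in> sets borel" unfolding self_overlap_def by measurable
    have "aconv (indicator ?B) c = (\<integral>\<^sup>+y. indicator (self_overlap ?B c) y \<partial>lborel)"
      unfolding aconv_def by (intro nn_integral_cong) (auto simp: self_overlap_def split: split_indicator)
    also have "\<dots> = emeasure lebesgue (self_overlap ?B c)" using sB by simp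
    also have "\<dots> \<le> emeasure lebesgue (self_overlap A c)"
      by (intro emeasure_mono self_overlap_sets A) (use B in \<open>auto simp: self_overlap_def\<close>)
    also have "\<dots> = ennreal (measure lebesgue (self_overlap A c))"
      by (rule emeasure_eq_measure2[OF self_overlap_lmeasurable[OF A]])
    also have "\<dots> \<le> ennreal (D A)"
      by (intro ennreal_leI self_overlap_le_D A)
    finally show ?thesis .
  qed
  show "0 \<le> D A" by (rule order_trans[OF measure_nonneg self_overlap_le_D[OF A]])
qed simp

lemma D_ge_linear:
  assumes A: "A \<in> sets lebesgue" "A \<subseteq> {0..<1}"
  shows "2 * measure lebesgue A - 1 \<le> D A"
proof -
  let ?R = "{y. 1 - y \<in> A}"
  have R: "measure lebesgue ?R = measure lebesgue A"
    by (simp add: measure_def emeasure_lebesgue_reflect[OF A(1)])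
  have mA: "A \<in> lmeasurable" by (rule lmeasurable_subset_unit) fact+
  have mR: "?R \<in> lmeasurable"
    using mA emeasure_lebesgue_reflect[OF A(1), of 1] sets_lebesgue_reflect[OF A(1), of 1]
    by (simp add: fmeasurable_def del: emeasure_completion)
  \<comment> \<open>The reflection of a half-open unit interval may contain 1, so the union is
    placed in the closed interval.\<close>
  have "measure lebesgue (A \<union> ?R) \<le> measure lebesgue {0..1::real}"
    by (rule measure_mono_fmeasurable) (use A mA mR in auto)
  moreover have "measure lebesgue (A \<union> ?R) = measure lebesgue A + measure lebesgue ?R - measure lebesgue (A \<inter> ?R)"
    by (rule measure_Un3) fact+
  moreover have "A \<inter> ?R = self_overlap A 1" by (auto simp: self_overlap_def)
  ultimately show ?thesis using R self_overlap_le_D[OF A, of 1] by simp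
qed

section \<open>Assembling the bounds for \<open>Delta\<close>\<close>

lemma Delta_ge_linear:
  assumes "0 \<le> \<epsilon>" "\<epsilon> \<le> 1"
  shows "2 * \<epsilon> - 1 \<le> Delta \<epsilon>"
  by (rule Delta_geI) (use assms D_ge_linear in auto)

lemma Delta_ge_quadratic:
  assumes "0 \<le> \<epsilon>" "\<epsilon> \<le> 1"
  shows "61/100 * \<epsilon>\<^sup>2 \<le> Delta \<epsilon>"
  by (rule Delta_geI) (use assms D_lower_bound in auto)

text \<open>Only 11/16 needs a construction: there \<open>96/121 * \<epsilon>\<^sup>2\<close> equals
  3/8, the value of \<open>2 * \<epsilon> - 1\<close>. Beyond it, filling up sets shows that
  \<open>Delta\<close> grows with slope at most 2.\<close>

lemma Delta_eq_linear:
  assumes \<epsilon>: "11/16 \<le> \<epsilon>" "\<epsilon> \<le> 1"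
  shows "Delta \<epsilon> = 2 * \<epsilon> - 1"
proof (rule antisym)
  have "Delta \<epsilon> - 2 * (\<epsilon> - 11/16) \<le> Delta (11/16)"
  proof (rule Delta_geI)
    fix A :: "real set" assume A: "A \<in> sets lebesgue" "A \<subseteq> {0..<1}" "measure lebesgue A = 11/16"
    show "Delta \<epsilon> - 2 * (\<epsilon> - 11/16) \<le> D A"
      using Delta_le_adjust[OF A(1,2), of \<epsilon>] A(3) \<epsilon> by auto
  qed auto
  moreover have "Delta (11/16) \<le> 3/8"
    using Delta_le_square_of_le_11_16[of "11/16"] by (simp add: power2_eq_square)
  ultimately show "Delta \<epsilon> \<le> 2 * \<epsilon> - 1" by simp
qed (use Delta_ge_linear[of \<epsilon>] \<epsilon> in auto)

text \<open>Up to 0.62 the cubic term is at most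
  \<open>(0.61 - 0.5546) * \<epsilon>\<^sup>2\<close>, so the quadratic bound suffices; beyond 0.62
  the linear bound takes over.\<close>

lemma Delta_ge_cubic:
  assumes \<epsilon>: "0 < \<epsilon>" "\<epsilon> \<le> 1"
  shows "0.5546 * \<epsilon>^2 + 0.088079 * \<epsilon>^3 \<le> Delta \<epsilon>"
proof (cases "\<epsilon> \<le> 62/100")
  case True
  have "0.088079 * \<epsilon> * \<epsilon>\<^sup>2 \<le> 0.0554 * \<epsilon>\<^sup>2"
    using True by (intro mult_right_mono) auto
  then have "0.5546 * \<epsilon>^2 + 0.088079 * \<epsilon>^3 \<le> 61/100 * \<epsilon>\<^sup>2"
    by (simp add: power3_eq_cube power2_eq_square)
  also have "\<dots> \<le> Delta \<epsilon>" using Delta_ge_quadratic[of \<epsilon>] \<epsilon> by auto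
  finally show ?thesis .
next
  case False
  \<comment> \<open>Chord bounds for the two convex powers on the interval from 0.62 to 1.\<close>
  have "0 \<le> (1 - \<epsilon>) * (\<epsilon> - 62/100)" using \<epsilon> False by simp
  moreover have "(1 - \<epsilon>) * (\<epsilon> - 62/100) = 162/100 * \<epsilon> - 62/100 - \<epsilon>\<^sup>2"
    by (simp add: power2_eq_square field_simps)
  ultimately have sq: "\<epsilon>\<^sup>2 \<le> 162/100 * \<epsilon> - 62/100" by linarith
  have "\<epsilon>^3 \<le> \<epsilon> * (162/100 * \<epsilon> - 62/100)"
    using mult_left_mono[OF sq, of \<epsilon>] \<epsilon> by (simp add: power3_eq_cube power2_eq_square)
  also have "\<dots> = 162/100 * \<epsilon>\<^sup>2 - 62/100 * \<epsilon>" by (simp add: power2_eq_square algebra_simps)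
  finally have "0.5546 * \<epsilon>^2 + 0.088079 * \<epsilon>^3 \<le> 2 * \<epsilon> - 1" using sq False by simp
  also have "\<dots> \<le> Delta \<epsilon>" using Delta_ge_linear[of \<epsilon>] \<epsilon> by auto
  finally show ?thesis .
qed

theorem theorem1p2:
  shows "(\<forall>\<epsilon>::real. 11/16 \<le> \<epsilon> \<and> \<epsilon> \<le> 1 \<longrightarrow> Delta \<epsilon> = 2 * \<epsilon> - 1)
       \<and> (\<forall>\<epsilon>::real. 1/2 \<le> \<epsilon> \<and> \<epsilon> \<le> 11/16 \<longrightarrow> Delta \<epsilon> \<ge> 2 * \<epsilon> - 1)
       \<and> (\<forall>\<epsilon>::real. 0 < \<epsilon> \<and> \<epsilon> \<le> 1 \<longrightarrow> Delta \<epsilon> \<ge> 0.591389 * \<epsilon>^2)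
       \<and> (\<forall>\<epsilon>::real. 0 < \<epsilon> \<and> \<epsilon> \<le> 1 \<longrightarrow> Delta \<epsilon> \<ge> 0.5546 * \<epsilon>^2 + 0.088079 * \<epsilon>^3)
       \<and> (\<forall>\<epsilon>::real. 0 < \<epsilon> \<and> \<epsilon> \<le> 11/16 \<longrightarrow>
             Delta \<epsilon> \<le> 96/121 * \<epsilon>^2 \<and> 96/121 * \<epsilon>^2 < 0.79339 * \<epsilon>^2)
       \<and> (\<forall>\<epsilon>::real. 0 < \<epsilon> \<and> \<epsilon> \<le> 1 \<longrightarrow>
             Delta \<epsilon> \<le> pi * \<epsilon>^2 / (1 + sqrt (1 - \<epsilon>))^2)
       \<and> (\<lambda>\<epsilon>::real. pi * \<epsilon>^2 / (1 + sqrt (1 - \<epsilon>))^2 - pi/4 * \<epsilon>^2)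
            \<in> O[at_right 0](\<lambda>\<epsilon>. \<epsilon>^3)"
proof (intro conjI allI impI)
  show "Delta \<epsilon> = 2 * \<epsilon> - 1" if "11/16 \<le> \<epsilon> \<and> \<epsilon> \<le> 1" for \<epsilon>
    using Delta_eq_linear that by blast
  show "2 * \<epsilon> - 1 \<le> Delta \<epsilon>" if "1/2 \<le> \<epsilon> \<and> \<epsilon> \<le> 11/16" for \<epsilon>
    by (rule Delta_ge_linear) (use that in auto)
  show "0.591389 * \<epsilon>^2 \<le> Delta \<epsilon>" if "0 < \<epsilon> \<and> \<epsilon> \<le> 1" for \<epsilon>
  proof -
    have "0.591389 * \<epsilon>^2 \<le> 61/100 * \<epsilon>^2" by simp
    also have "\<dots> \<le> Delta \<epsilon>" by (rule Delta_ge_quadratic) (use that in auto)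
    finally show ?thesis .
  qed
  show "0.5546 * \<epsilon>^2 + 0.088079 * \<epsilon>^3 \<le> Delta \<epsilon>" if "0 < \<epsilon> \<and> \<epsilon> \<le> 1" for \<epsilon>
    using Delta_ge_cubic that by blast
  show "Delta \<epsilon> \<le> 96/121 * \<epsilon>^2" if "0 < \<epsilon> \<and> \<epsilon> \<le> 11/16" for \<epsilon>
    using Delta_le_square_of_le_11_16 that by blast
  show "96/121 * \<epsilon>^2 < 0.79339 * \<epsilon>^2" if "0 < \<epsilon> \<and> \<epsilon> \<le> 11/16" for \<epsilon> :: real
    using that by auto
  show "Delta \<epsilon> \<le> pi * \<epsilon>^2 / (1 + sqrt (1 - \<epsilon>))^2" if "0 < \<epsilon> \<and> \<epsilon> \<le> 1" for \<epsilon>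
    using Delta_le_pi that by blast
  \<comment> \<open>Near 0 the factor \<open>1 / (1 + sqrt (1 - \<epsilon>))^2\<close> expands as
    \<open>1/4 + \<epsilon> / 8\<close> plus higher terms, so the difference is asymptotic to
    \<open>pi / 8 * \<epsilon>^3\<close>.\<close>
  show "(\<lambda>\<epsilon>::real. pi * \<epsilon>^2 / (1 + sqrt (1 - \<epsilon>))^2 - pi/4 * \<epsilon>^2) \<in> O[at_right 0](\<lambda>\<epsilon>. \<epsilon>^3)"
    by real_asymp
qed

end
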